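(* Let $p$ be fixed and consider the linear model $y_i=\mathbf{x}_i^T\mathbf{b}^*+\epsilon_i$, $i=1,\dots,n$, with $\mathbf{x}_i\in\mathbb{R}^p$, $\mathbf{b}^*\in\mathbb{R}^p$ and $\epsilon_1,\dots,\epsilon_n$ i.i.d. with mean $0$ and variance $\sigma^2$. Let $\mathbf{y}=(y_1,\dots,y_n)^T$, $\mathbf{X}=[\mathbf{x}_1,\dots,\mathbf{x}_n]^T\in\mathbb{R}^{n\times p}$, and assume $\mathbf{X}^T\mathbf{X}/n\to\mathbf{C}$ for a positive definite matrix $\mathbf{C}$. Let $\mathcal{A}=\{j:b^*_j\neq0\}$, let $\mathbf{C}_{11}$ be the submatrix of $\mathbf{C}$ with rows and columns indexed by $\mathcal{A}$, and let $\mathbf{b}^*_1=(b^*_j)_{j\in\mathcal{A}}$. Let $\mathbf{b}^{(0)}=(b^{(0)}_1,\dots,b^{(0)}_p)^T$ be a root-$n$-consistent estimator of $\mathbf{b}^*$ and define \[ \mathbf{b}^{(1)}_n=\arg\min_{\mathbf{b}}\ \|\mathbf{y}-\mathbf{X}\mathbf{b}\|_2^2+\sum_{j=1}^p\frac{\eta_n}{\sqrt{1+2\alpha_n|b^{(0)}_j|}}\,|b_j|. \] Let $\mathbf{b}^{(1)}_{n1}=(b^{(1)}_{nj})_{j\in\mathcal{A}}$ and $\mathcal{A}^{(1)}_n=\{j:b^{(1)}_{nj}\neq0\}$. Suppose $n^{-3/4}\eta_n\to0$, $\eta_n/\sqrt n\to\infty$ and $\alpha_n/\sqrt n\to c_1$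 with $c_1\in(0,\infty)$. Then (1) $\lim_{n\to\infty}P(\mathcal{A}^{(1)}_n=\mathcal{A})=1$; (2) $\sqrt n(\mathbf{b}^{(1)}_{n1}-\mathbf{b}^*_1)\xrightarrow{d}N(\mathbf{0},\sigma^2\mathbf{C}_{11}^{-1})$.
   Context: Root-$n$-consistent means $\sqrt n(\mathbf{b}^{(0)}-\mathbf{b}^* )=O_p(1)$. *)

theory Defs
  imports "HOL-Probability.Probability"
begin

definition pos_def_mat :: "real^'n^'n \<Rightarrow> bool" where
  "pos_def_mat C \<longleftrightarrow> transpose C = C \<and> (\<forall>v. v \<noteq> 0 \<longrightarrow> v \<bullet> (C *v v) > 0)"

definition bounded_in_prob :: "'a measure \<Rightarrow> (nat \<Rightarrow> 'a \<Rightarrow> real^'n) \<Rightarrow> bool" where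
  "bounded_in_prob M Z \<longleftrightarrow>
     (\<forall>e>0. \<exists>K. \<exists>N. \<forall>n\<ge>N. measure M {\<omega>\<in>space M. norm (Z n \<omega>) > K} < e)"

definition gaussian_law :: "real^'n^'n \<Rightarrow> (real^'n) measure \<Rightarrow> bool" where
  "gaussian_law S \<mu> \<longleftrightarrow> prob_space \<mu> \<and> sets \<mu> = sets borel \<and>
     (\<forall>t. (LINT x|\<mu>. cis (t \<bullet> x)) = complex_of_real (exp (- (t \<bullet> (S *v t)) / 2)))"

definition conv_in_distr :: "'a measure \<Rightarrow> (nat \<Rightarrow> 'a \<Rightarrow> real^'n) \<Rightarrow> (real^'n) measure \<Rightarrow> bool" where
  "conv_in_distr M Y \<mu> \<longleftrightarrow>
     (\<forall>f :: real^'n \<Rightarrow> real. continuous_on UNIV f \<longrightarrow> bounded (range f) \<longrightarrow>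
        (\<lambda>n. integral\<^sup>L (distr M borel (Y n)) f) \<longlonglongrightarrow> integral\<^sup>L \<mu> f)"

text \<open>Coordinates of v indexed by A, the others set to zero (embedding of the subvector).\<close>
definition restrict_vec :: "'n set \<Rightarrow> real^'n \<Rightarrow> real^'n" where
  "restrict_vec A v = (\<chi> j. if j \<in> A then v $ j else 0)"

text \<open>The matrix (C_11)^{-1} (C_11 = rows/columns of C in A), embedded into the
  full index set with zeros outside A\<times>A.  It is computed as the A\<times>A block of the
  inverse of the block-diagonal matrix diag(C_11, I).\<close>
definition sub_inv_embed :: "'n set \<Rightarrow> real^'n^'n \<Rightarrow> real^'n^'n" where
  "sub_inv_embed A C =
     (let B = (\<chi> i j. if i \<in> A \<and> j \<in> A then C $ i $ j else if i = j then 1 else 0)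
      in (\<chi> i j. if i \<in> A \<and> j \<in> A then matrix_inv B $ i $ j else 0))"

end

theory Submission
  imports Defs
begin

text \<open>
  Put \<open>u = sqrt n (b1 - b*)\<close> and \<open>W = X\<^sup>T \<epsilon> / sqrt n\<close>. With probability close to one \<open>W\<close> and
  \<open>sqrt n (b0 - b*)\<close> are bounded. On that event the penalty weights divided by \<open>sqrt n\<close> tend to \<open>0\<close> on
  the active set and to infinity off it, so comparing \<open>u\<close> with suitable competitors in the rescaled
  objective shows that \<open>u\<close> is bounded, vanishes off the active set, and is uniformly close to
  \<open>S W\<close>, where \<open>S\<close> is the embedded inverse of the active block of \<open>C\<close>. No
  optimality conditions (subgradients) are needed. The characteristic function of \<open>W\<close> converges
  by a Lindeberg argument, and a continuity theorem for tight sequences in \<open>R\<^sup>p\<close>, proved through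
  Stone-Weierstrass for trigonometric polynomials, gives convergence in distribution.
\<close>

section \<open>Weak convergence from characteristic functions\<close>

text \<open>The two rate conditions on \<open>\<eta>\<close> are what makes the weights separate the
  coordinates. On the active set the initial estimate stays away from 0, so with
  \<open>\<alpha>\<close> of order sqrt n the root in the weight has order n^(1/4), and the weight
  over sqrt n has order \<open>\<eta> n\<close> / n^(3/4), which vanishes. Off the active set the
  initial estimate is itself of order 1 / sqrt n, the root stays bounded, and the weight over sqrt n
  has order \<open>\<eta> n\<close> / sqrt n, which diverges. Because of this divergence the
  rescaled objective has no finite limit function, and minimizers are compared directly by
  inequalities. These hold for every noise vector and every initial estimate within fixed bounds;
  randomness enters only through the probability of those bounds. The Gaussian law is therefore
  handled through its characteristic function, and its existence is proved separately.\<close>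

inductive_set trig_poly :: "('b::euclidean_space \<Rightarrow> real) set" where
  cos: "(\<lambda>x. cos (t \<bullet> x)) \<in> trig_poly"
| sin: "(\<lambda>x. sin (t \<bullet> x)) \<in> trig_poly"
| add: "\<lbrakk>f \<in> trig_poly; g \<in> trig_poly\<rbrakk> \<Longrightarrow> (\<lambda>x. f x + g x) \<in> trig_poly"
| scale: "f \<in> trig_poly \<Longrightarrow> (\<lambda>x. c * f x) \<in> trig_poly"

lemma trig_poly_const: "(\<lambda>x. c) \<in> trig_poly"
  using trig_poly.scale[OF trig_poly.cos[of 0], of c] by simp

text \<open>Products are no constructor: membership means a finite linear combination of sines and
  cosines, which is what lets integrals be read off from characteristic functions. The closure under
  products that Stone-Weierstrass requires has to come from the product-to-sum identities.\<close>

lemma trig_poly_mult_cos: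
  assumes "f \<in> trig_poly" shows "(\<lambda>x. cos (t \<bullet> x) * f x) \<in> trig_poly"
  using assms
proof induction
  case (cos s)
  have "(\<lambda>x. (1/2) * (cos ((t - s) \<bullet> x) + cos ((t + s) \<bullet> x))) \<in> trig_poly"
    by (intro trig_poly.intros)
  then show ?case by (simp add: cos_times_cos inner_diff_left inner_add_left)
next
  case (sin s)
  have "(\<lambda>x. (1/2) * (sin ((t + s) \<bullet> x) + (-1) * sin ((t - s) \<bullet> x))) \<in> trig_poly"
    by (intro trig_poly.intros)
  then show ?case by (simp add: cos_times_sin inner_diff_left inner_add_left)
next
  case (add f g)
  then show ?case using trig_poly.add by (fastforce simp: distrib_left)
next
  case (scale f c)
  from trig_poly.scale[OF scale.IH, of c] show ?case by (simp add: mult.left_commute)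
qed

lemma trig_poly_mult_sin:
  assumes "f \<in> trig_poly" shows "(\<lambda>x. sin (t \<bullet> x) * f x) \<in> trig_poly"
  using assms
proof induction
  case (cos s)
  have "(\<lambda>x. (1/2) * (sin ((t + s) \<bullet> x) + sin ((t - s) \<bullet> x))) \<in> trig_poly"
    by (intro trig_poly.intros)
  then show ?case by (simp add: sin_times_cos inner_diff_left inner_add_left)
next
  case (sin s)
  have "(\<lambda>x. (1/2) * (cos ((t - s) \<bullet> x) + (-1) * cos ((t + s) \<bullet> x))) \<in> trig_poly"
    by (intro trig_poly.intros)
  then show ?case by (simp add: sin_times_sin inner_diff_left inner_add_left)
next
  case (add f g)
  then show ?case using trig_poly.add by (fastforce simp: distrib_left)
next
  case (scale f c)
  from trig_poly.scale[OF scale.IH, of c] show ?case by (simp add: mult.left_commute)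
qed

lemma trig_poly_mult:
  assumes "f \<in> trig_poly" "g \<in> trig_poly" shows "(\<lambda>x. f x * g x) \<in> trig_poly"
  using assms(1)
proof induction
  case (add f h)
  then show ?case using trig_poly.add by (fastforce simp: distrib_right)
next
  case (scale f c)
  from trig_poly.scale[OF scale.IH, of c] show ?case by (simp add: mult.assoc)
qed (simp_all add: assms(2) trig_poly_mult_cos trig_poly_mult_sin)

lemma trig_poly_continuous:
  assumes "f \<in> trig_poly" shows "continuous_on S f"
  using assms by induction (auto intro!: continuous_intros)

lemma trig_poly_bounded:
  assumes "f \<in> trig_poly" shows "\<exists>B. \<forall>x. \<bar>f x\<bar> \<le> B"
  using assms
proof induction
  case (add f g)
  then obtain B B' where "\<And>x. \<bar>f x\<bar> \<le> B" "\<And>x. \<bar>g x\<bar> \<le> B'" by auto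
  then have "\<bar>f x + g x\<bar> \<le> B + B'" for x by (meson abs_triangle_ineq add_mono order_trans)
  then show ?case by blast
next
  case (scale f c)
  then obtain B where "\<And>x. \<bar>f x\<bar> \<le> B" by auto
  then have "\<bar>c * f x\<bar> \<le> \<bar>c\<bar> * B" for x by (simp add: abs_mult mult_left_mono)
  then show ?case by blast
qed (auto intro: exI[of _ 1])

text \<open>Along \<open>t\<close>, the rescaled difference of the points, the two phases differ by
  exactly 1. Equal sines and cosines would make 1 an integer multiple of 2 pi, impossible since 2 pi
  > 6.\<close>

lemma trig_poly_separates:
  fixes x y :: "'b::euclidean_space"
  assumes "x \<noteq> y" shows "\<exists>f\<in>trig_poly. f x \<noteq> f y"
proof (rule ccontr)
  assume "\<not> ?thesis"
  then have *: "f x = f y" if "f \<in> trig_poly" for f using that by auto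
  define t where "t = (1 / ((x - y) \<bullet> (x - y))) *\<^sub>R (x - y)"
  have 1: "t \<bullet> x = t \<bullet> y + 1"
  proof -
    have "t \<bullet> (x - y) = 1" using assms by (simp add: t_def)
    then show ?thesis by (simp add: inner_diff_right)
  qed
  have "cos (t \<bullet> x) = cos (t \<bullet> y)" "sin (t \<bullet> x) = sin (t \<bullet> y)"
    using *[OF trig_poly.cos] *[OF trig_poly.sin] by auto
  then obtain n where n: "t \<bullet> x = t \<bullet> y + 2 * pi * of_int n"
    using sin_cos_eq_iff[of "t \<bullet> x" "t \<bullet> y"] by (auto simp: algebra_simps)
  then have "1 = 2 * pi * of_int n" using 1 by simp
  moreover have "2 * pi * of_int n \<ge> 6 * of_int n" if "n \<ge> 1"
    using pi_gt3 that by (intro mult_right_mono) auto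
  ultimately show False
  proof (cases "n \<ge> 1")
    case False
    then have "of_int n \<le> (0::real)" by simp
    then have "2 * pi * of_int n \<le> 0" by (simp add: mult_nonneg_nonpos)
    with \<open>1 = _\<close> show ?thesis by simp
  next
    case True
    then have "of_int n \<ge> (1::real)" by simp
    then show ?thesis using \<open>1 = _\<close> \<open>n \<ge> 1 \<Longrightarrow> _\<close>[OF True] by linarith
  qed
qed

lemma trig_poly_compose_polynomial:
  fixes p :: "real \<Rightarrow> real"
  assumes "real_polynomial_function p" "T \<in> trig_poly"
  shows "(\<lambda>x. p (T x)) \<in> trig_poly"
  using assms(1)
proof induction
  case (linear f)
  interpret bounded_linear f by fact
  \<comment> \<open>A bounded linear function on the reals is multiplication by \<open>f 1\<close>,
    so this case is a scaling.\<close>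
  have f1: "f y = y * f 1" for y using scaleR[of y 1] by simp
  have "(\<lambda>x. f 1 * T x) = (\<lambda>x. f (T x))" by (subst (2) f1) (rule ext, rule mult.commute)
  then show ?case using trig_poly.scale[OF assms(2), of "f 1"] by simp
qed (auto intro: trig_poly_const trig_poly.add trig_poly_mult)

text \<open>A trigonometric polynomial that is close to \<open>f\<close> on the ball may be huge outside it.
  Composing it with a polynomial that approximates truncation at the bound of \<open>f\<close> cures this.\<close>
lemma trig_poly_approx:
  fixes f :: "'b::euclidean_space \<Rightarrow> real"
  assumes f: "continuous_on UNIV f" and B: "\<And>x. \<bar>f x\<bar> \<le> B" and e: "0 < e"
  shows "\<exists>g\<in>trig_poly. (\<forall>x. \<bar>g x\<bar> \<le> B + e) \<and> (\<forall>x\<in>cball 0 K. \<bar>f x - g x\<bar> \<le> e)"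
proof -
  interpret function_ring_on trig_poly "cball (0::'b) K"
    by unfold_locales (auto intro: trig_poly_continuous trig_poly.add trig_poly_mult
      trig_poly_const trig_poly_separates)
  have "0 < e / 2" using e by simp
  obtain T where T: "T \<in> trig_poly" "\<And>x. x \<in> cball 0 K \<Longrightarrow> \<bar>f x - T x\<bar> < e / 2"
    using Stone_Weierstrass_basic[OF continuous_on_subset[OF f subset_UNIV] \<open>0 < e / 2\<close>] by auto
  obtain D where D: "\<And>x. \<bar>T x\<bar> \<le> D" using trig_poly_bounded[OF T(1)] by auto
  \<comment> \<open>Clamping to [-B, B] fixes the values of \<open>f\<close> and is 1-Lipschitz, so
    on the ball \<open>c (T x)\<close> is as close to \<open>f x\<close> as \<open>T x\<close> is,
    while it is bounded by \<open>B\<close> everywhere.\<close>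
  define c where "c = (\<lambda>s::real. max (-B) (min B s))"
  have "0 \<le> B" using B[of 0] by linarith
  have c_bd: "\<bar>c s\<bar> \<le> B" for s using \<open>0 \<le> B\<close> by (auto simp: c_def)
  have c_lip: "\<bar>c s - c r\<bar> \<le> \<bar>s - r\<bar>" for s r by (auto simp: c_def max_def min_def)
  have c_f: "c (f x) = f x" for x using B[of x] by (auto simp: c_def)
  \<comment> \<open>\<open>D\<close> bounds \<open>T\<close> on the whole space, so approximating
    the clamp on [-D, D] controls \<open>q (T x)\<close> at every \<open>x\<close>, also outside the
    ball.\<close>
  have "continuous_on {-D..D} c" unfolding c_def by (intro continuous_intros)
  then obtain q where q: "real_polynomial_function q" "\<And>s. s \<in> {-D..D} \<Longrightarrow> \<bar>c s - q s\<bar> < e / 2"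
    using Stone_Weierstrass_real_polynomial_function[of "{-D..D}" c "e/2"] \<open>0 < e / 2\<close> by auto
  have qT: "\<bar>c (T x) - q (T x)\<bar> < e / 2" for x using D[of x] by (intro q(2)) auto
  show ?thesis
  proof (intro bexI conjI allI ballI)
    show "(\<lambda>x. q (T x)) \<in> trig_poly" by (rule trig_poly_compose_polynomial[OF q(1) T(1)])
    show "\<bar>q (T x)\<bar> \<le> B + e" for x using qT[of x] c_bd[of "T x"] e by linarith
    show "\<bar>f x - q (T x)\<bar> \<le> e" if "x \<in> cball 0 K" for x
      using qT[of x] c_lip[of "f x" "T x"] T(2)[OF that] c_f[of x] by linarith
  qed
qed

lemma (in prob_space) integrable_bounded_continuous:
  fixes Y :: "'a \<Rightarrow> 'b::euclidean_space" and f :: "'b \<Rightarrow> 'c::{banach, second_countable_topology}"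
  assumes "Y \<in> borel_measurable M" "continuous_on UNIV f" "\<And>x. norm (f x) \<le> B"
  shows "integrable M (\<lambda>\<omega>. f (Y \<omega>))"
  using measurable_compose[OF assms(1) borel_measurable_continuous_onI[OF assms(2)]] assms(3)
  by (intro integrable_const_bound[of _ B]) auto

lemma trig_poly_integral_tendsto:
  fixes Y :: "nat \<Rightarrow> 'a \<Rightarrow> 'b::euclidean_space"
  assumes M: "prob_space M" and Y: "\<And>n. Y n \<in> borel_measurable M"
    and \<mu>: "prob_space \<mu>" "sets \<mu> = sets borel"
    and cf: "\<And>t. (\<lambda>n. LINT \<omega>|M. cis (t \<bullet> Y n \<omega>)) \<longlonglongrightarrow> (LINT x|\<mu>. cis (t \<bullet> x))"
    and T: "T \<in> trig_poly"
  shows "(\<lambda>n. LINT \<omega>|M. T (Y n \<omega>)) \<longlonglongrightarrow> (LINT x|\<mu>. T x)"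
proof -
  interpret M: prob_space M by fact
  interpret \<mu>: prob_space \<mu> by fact
  have id: "(\<lambda>x. x) \<in> borel_measurable \<mu>" using \<mu>(2) by (simp add: measurable_ident_sets)
  have c: "continuous_on UNIV (\<lambda>x. cis (t \<bullet> x))" for t :: 'b by (intro continuous_intros)
  have int: "integrable M (\<lambda>\<omega>. cis (t \<bullet> Y n \<omega>))" "integrable \<mu> (\<lambda>x. cis (t \<bullet> x))" for t n
    using M.integrable_bounded_continuous[OF Y c, where B=1] \<mu>.integrable_bounded_continuous[OF id c, where B=1]
    by auto
  show ?thesis using T
  proof induction
    case (cos t)
    have "(\<lambda>n. Re (LINT \<omega>|M. cis (t \<bullet> Y n \<omega>))) \<longlonglongrightarrow> Re (LINT x|\<mu>. cis (t \<bullet> x))"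
      by (intro tendsto_Re cf)
    then show ?case by (simp add: integral_Re[OF int(1), symmetric] integral_Re[OF int(2), symmetric])
  next
    case (sin t)
    have "(\<lambda>n. Im (LINT \<omega>|M. cis (t \<bullet> Y n \<omega>))) \<longlonglongrightarrow> Im (LINT x|\<mu>. cis (t \<bullet> x))"
      by (intro tendsto_Im cf)
    then show ?case by (simp add: integral_Im[OF int(1), symmetric] integral_Im[OF int(2), symmetric])
  next
    case (add f g)
    have "integrable M (\<lambda>\<omega>. h (Y n \<omega>))" "integrable \<mu> h" if h: "h \<in> trig_poly" for h n
    proof -
      obtain B where B: "\<And>x. norm (h x) \<le> B" using trig_poly_bounded[OF h] by auto
      show "integrable M (\<lambda>\<omega>. h (Y n \<omega>))" "integrable \<mu> h"
        using M.integrable_bounded_continuous[OF Y trig_poly_continuous[OF h] B]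
          \<mu>.integrable_bounded_continuous[OF id trig_poly_continuous[OF h] B] by auto
    qed
    with add show ?case by (auto intro!: tendsto_add)
  next
    case (scale f c)
    then show ?case by (auto intro!: tendsto_intros)
  qed
qed

text \<open>On the ball the integrands differ by at most \<open>e\<close>, outside it by the crude
  \<open>B + B'\<close>, paid for by the mass out there. This serves for the sequence and, with
  \<open>Z\<close> the identity, for the limit law.\<close>

lemma (in prob_space) integral_diff_le_of_close_on_cball:
  fixes Z :: "'a \<Rightarrow> 'b::euclidean_space" and f g :: "'b \<Rightarrow> 'c::{banach, second_countable_topology}"
  assumes Z: "Z \<in> borel_measurable M" and f: "continuous_on UNIV f" "\<And>x. norm (f x) \<le> B"
    and g: "continuous_on UNIV g" "\<And>x. norm (g x) \<le> B'"
    and e: "0 \<le> e" and close: "\<And>x. norm x \<le> K \<Longrightarrow> norm (f x - g x) \<le> e"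
  shows "norm ((LINT \<omega>|M. f (Z \<omega>)) - (LINT \<omega>|M. g (Z \<omega>)))
    \<le> e + (B + B') * prob {\<omega>\<in>space M. norm (Z \<omega>) > K}"
proof -
  note [measurable] = Z
  have int: "integrable M (\<lambda>\<omega>. f (Z \<omega>))" "integrable M (\<lambda>\<omega>. g (Z \<omega>))"
    using integrable_bounded_continuous[OF Z f] integrable_bounded_continuous[OF Z g] .
  have "0 \<le> B" "0 \<le> B'" using f(2) g(2) norm_ge_zero order_trans by blast+
  let ?E = "{\<omega>\<in>space M. norm (Z \<omega>) > K}"
  have E: "?E \<in> events" by measurable
  have "norm ((LINT \<omega>|M. f (Z \<omega>)) - (LINT \<omega>|M. g (Z \<omega>))) = norm (LINT \<omega>|M. f (Z \<omega>) - g (Z \<omega>))"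
    using int by simp
  also have "\<dots> \<le> (LINT \<omega>|M. norm (f (Z \<omega>) - g (Z \<omega>)))" by (rule integral_norm_bound)
  also have "\<dots> \<le> (LINT \<omega>|M. e + (B + B') * indicator ?E \<omega>)"
  proof (rule integral_mono)
    show "integrable M (\<lambda>\<omega>. norm (f (Z \<omega>) - g (Z \<omega>)))" using int by simp
    show "integrable M (\<lambda>\<omega>. e + (B + B') * indicator ?E \<omega>)" using E by (auto intro!: integrable_real_mult_indicator simp: integrable_indicator_iff less_top[symmetric])
    fix \<omega> assume \<omega>: "\<omega> \<in> space M"
    show "norm (f (Z \<omega>) - g (Z \<omega>)) \<le> e + (B + B') * indicator ?E \<omega>"
    proof (cases "norm (Z \<omega>) \<le> K")
      case True then show ?thesis using close[OF True] by simp
    next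
      case False
      have "norm (f (Z \<omega>) - g (Z \<omega>)) \<le> norm (f (Z \<omega>)) + norm (g (Z \<omega>))" by (rule norm_triangle_ineq4)
      also have "\<dots> \<le> B + B'" by (intro add_mono f g)
      finally show ?thesis using False \<omega> e by simp
    qed
  qed
  also have "\<dots> = e + (B + B') * prob ?E" using E by (simp add: prob_space less_top[symmetric])
  finally show ?thesis .
qed

text \<open>Continuity from above: the sets where the norm exceeds an integer decrease to the empty
  set.\<close>

lemma prob_space_borel_tight:
  fixes \<mu> :: "'b::euclidean_space measure"
  assumes "prob_space \<mu>" "sets \<mu> = sets borel" "0 < e"
  shows "\<exists>K. measure \<mu> {x\<in>space \<mu>. norm x > K} < e"
proof -
  interpret prob_space \<mu> by fact
  have [measurable]: "(\<lambda>x. x) \<in> borel_measurable \<mu>" using assms(2) by (simp add: measurable_ident_sets)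
  let ?A = "\<lambda>n::nat. {x\<in>space \<mu>. norm x > real n}"
  have "(\<lambda>n. measure \<mu> (?A n)) \<longlonglongrightarrow> measure \<mu> (\<Inter>n. ?A n)"
  proof (rule finite_Lim_measure_decseq)
    show "range ?A \<subseteq> events" by auto
    show "decseq ?A" by (auto simp: decseq_def)
  qed
  also have "(\<Inter>n. ?A n) = {}" by auto (meson less_asym reals_Archimedean2)
  finally have "(\<lambda>n. measure \<mu> (?A n)) \<longlonglongrightarrow> 0" by simp
  from order_tendstoD(2)[OF this \<open>0 < e\<close>] show ?thesis by (auto simp: eventually_sequentially)
qed

text \<open>Tightness is a hypothesis here because in the application it comes directly from the
  bound on the minimizers. It confines all but a little mass to one ball, on which \<open>f\<close>
  can be replaced by a trigonometric polynomial.\<close>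

theorem levy_continuity_tight:
  fixes Y :: "nat \<Rightarrow> 'a \<Rightarrow> 'b::euclidean_space" and f :: "'b \<Rightarrow> real"
  assumes M: "prob_space M" and Y: "\<And>n. Y n \<in> borel_measurable M"
    and \<mu>: "prob_space \<mu>" "sets \<mu> = sets borel"
    and cf: "\<And>t. (\<lambda>n. LINT \<omega>|M. cis (t \<bullet> Y n \<omega>)) \<longlonglongrightarrow> (LINT x|\<mu>. cis (t \<bullet> x))"
    and tight: "\<And>e. 0 < e \<Longrightarrow> \<exists>K. \<forall>\<^sub>F n in sequentially. measure M {\<omega>\<in>space M. norm (Y n \<omega>) > K} < e"
    and f: "continuous_on UNIV f" "bounded (range f)"
  shows "(\<lambda>n. LINT \<omega>|M. f (Y n \<omega>)) \<longlonglongrightarrow> (LINT x|\<mu>. f x)"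
proof (rule LIMSEQ_I)
  interpret M: prob_space M by fact
  interpret \<mu>: prob_space \<mu> by fact
  have id: "(\<lambda>x. x) \<in> borel_measurable \<mu>" using \<mu>(2) by (simp add: measurable_ident_sets)
  obtain B where B: "\<And>x. norm (f x) \<le> B" using f(2) by (auto simp: bounded_iff)
  have "0 \<le> B" using B[of 0] by (meson norm_ge_zero order_trans)
  fix r :: real assume "0 < r"
  \<comment> \<open>The error budget is 2e + 2e + e: replacing \<open>f\<close> by \<open>T\<close>
    under \<open>Y n\<close> and under \<open>\<mu>\<close>, and convergence of the integrals of
    \<open>T\<close>. As e \<le> 1, the factor 2B + e is at most 2B + 1, the denominator of
    \<open>d\<close>.\<close>
  define e where "e = min 1 (r / 5)"
  define d where "d = e / (2 * B + 1)"
  have e: "0 < e" "e \<le> 1" "5 * e \<le> r" using \<open>0 < r\<close> by (auto simp: e_def)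
  have d: "0 < d" using e \<open>0 \<le> B\<close> by (auto simp: d_def)
  obtain K1 where K1: "\<forall>\<^sub>F n in sequentially. measure M {\<omega>\<in>space M. norm (Y n \<omega>) > K1} < d"
    using tight[OF d] by blast
  obtain K2 where K2: "measure \<mu> {x\<in>space \<mu>. norm x > K2} < d"
    using prob_space_borel_tight[OF \<mu> d] by blast
  obtain T where T: "T \<in> trig_poly" "\<And>x. norm (T x) \<le> B + e"
    "\<And>x. x \<in> cball 0 (max K1 K2) \<Longrightarrow> \<bar>f x - T x\<bar> \<le> e"
    using trig_poly_approx[OF f(1) B[unfolded real_norm_def] e(1), of "max K1 K2"] by auto
  have close: "norm (f x - T x) \<le> e" if "norm x \<le> max K1 K2" for x
    using T(3)[of x] that by simp
  have small: "e + (B + (B + e)) * p \<le> 2 * e" if "p \<le> d" "0 \<le> p" for p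
  proof -
    have "(B + (B + e)) * p \<le> (2 * B + 1) * d" using that e \<open>0 \<le> B\<close> by (intro mult_mono) auto
    also have "\<dots> = e" using \<open>0 \<le> B\<close> by (simp add: d_def)
    finally show ?thesis by simp
  qed
  have \<mu>b: "norm ((LINT x|\<mu>. f x) - (LINT x|\<mu>. T x)) \<le> e + (B + (B + e)) * measure \<mu> {x\<in>space \<mu>. norm x > max K1 K2}"
    by (rule \<mu>.integral_diff_le_of_close_on_cball[OF id f(1) B trig_poly_continuous[OF T(1)] T(2)])
      (use e close in auto)
  also have "\<dots> \<le> 2 * e"
  proof (rule small)
    have "measure \<mu> {x\<in>space \<mu>. norm x > max K1 K2} \<le> measure \<mu> {x\<in>space \<mu>. norm x > K2}"
      using id by (intro \<mu>.finite_measure_mono) auto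
    with K2 show "measure \<mu> {x\<in>space \<mu>. norm x > max K1 K2} \<le> d" by simp
  qed simp
  finally have \<mu>b: "norm ((LINT x|\<mu>. f x) - (LINT x|\<mu>. T x)) \<le> 2 * e" .
  have lim: "(\<lambda>n. LINT \<omega>|M. T (Y n \<omega>)) \<longlonglongrightarrow> (LINT x|\<mu>. T x)"
    by (rule trig_poly_integral_tendsto[OF M Y \<mu> cf T(1)])
  have "\<forall>\<^sub>F n in sequentially. norm ((LINT \<omega>|M. f (Y n \<omega>)) - (LINT x|\<mu>. f x)) < 5 * e"
    using K1 tendstoD[OF lim e(1)]
  proof eventually_elim
    case (elim n)
    have "norm ((LINT \<omega>|M. f (Y n \<omega>)) - (LINT \<omega>|M. T (Y n \<omega>))) \<le>
      e + (B + (B + e)) * measure M {\<omega>\<in>space M. norm (Y n \<omega>) > max K1 K2}"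
      by (rule M.integral_diff_le_of_close_on_cball[OF Y f(1) B trig_poly_continuous[OF T(1)] T(2)])
        (use e close in auto)
    also have "\<dots> \<le> 2 * e"
    proof (rule small)
      have "measure M {\<omega>\<in>space M. norm (Y n \<omega>) > max K1 K2} \<le> measure M {\<omega>\<in>space M. norm (Y n \<omega>) > K1}"
        using Y by (intro M.finite_measure_mono) auto
      with elim show "measure M {\<omega>\<in>space M. norm (Y n \<omega>) > max K1 K2} \<le> d" by simp
    qed simp
    finally show ?case using \<mu>b elim(2) by (simp add: dist_real_def)
  qed
  then show "\<exists>N. \<forall>n\<ge>N. norm ((LINT \<omega>|M. f (Y n \<omega>)) - (LINT x|\<mu>. f x)) < r"
    using e(3) by (force simp: eventually_sequentially)
qed

section \<open>Characteristic functions of nearby random vectors\<close>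

lemma norm_cis_diff_le: "norm (cis a - cis b) \<le> \<bar>a - b\<bar>"
proof -
  have "cis a - cis b = cis b * (cis (a - b) - 1)" by (simp add: cis_mult right_diff_distrib)
  then have "norm (cis a - cis b) = norm (cis (a - b) - 1)" by (simp add: norm_mult)
  also have "\<dots> \<le> \<bar>a - b\<bar>" using iexp_approx1[of "a - b" 0] by (simp add: cis_conv_exp)
  finally show ?thesis .
qed

text \<open>A quantitative form of Slutsky's theorem: \<open>cis\<close> is 1-Lipschitz where the
  vectors are \<open>r\<close>-close, and on the exceptional event the integrands differ by at most
  2.\<close>

lemma (in prob_space) cf_diff_le:
  fixes Y Z :: "'a \<Rightarrow> 'b::euclidean_space"
  assumes Y: "Y \<in> borel_measurable M" and Z: "Z \<in> borel_measurable M" and E: "E \<in> events"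
    and r: "0 \<le> r" "\<And>\<omega>. \<omega> \<in> E \<Longrightarrow> norm (Y \<omega> - Z \<omega>) \<le> r"
  shows "norm ((LINT \<omega>|M. cis (t \<bullet> Y \<omega>)) - (LINT \<omega>|M. cis (t \<bullet> Z \<omega>))) \<le> norm t * r + 2 * prob (space M - E)"
proof -
  have c: "continuous_on UNIV (\<lambda>x::'b. cis (t \<bullet> x))" by (intro continuous_intros)
  have int: "integrable M (\<lambda>\<omega>. cis (t \<bullet> Y \<omega>))" "integrable M (\<lambda>\<omega>. cis (t \<bullet> Z \<omega>))"
    using integrable_bounded_continuous[OF Y c, where B=1] integrable_bounded_continuous[OF Z c, where B=1] by auto
  have E': "space M - E \<in> events" using E by auto
  have "norm ((LINT \<omega>|M. cis (t \<bullet> Y \<omega>)) - (LINT \<omega>|M. cis (t \<bullet> Z \<omega>))) = norm (LINT \<omega>|M. cis (t \<bullet> Y \<omega>) - cis (t \<bullet> Z \<omega>))"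
    using int by simp
  also have "\<dots> \<le> (LINT \<omega>|M. norm (cis (t \<bullet> Y \<omega>) - cis (t \<bullet> Z \<omega>)))" by (rule integral_norm_bound)
  also have "\<dots> \<le> (LINT \<omega>|M. norm t * r + 2 * indicator (space M - E) \<omega>)"
  proof (rule integral_mono)
    show "integrable M (\<lambda>\<omega>. norm (cis (t \<bullet> Y \<omega>) - cis (t \<bullet> Z \<omega>)))" using int by simp
    show "integrable M (\<lambda>\<omega>. norm t * r + 2 * indicator (space M - E) \<omega>)"
      using E' by (auto simp: integrable_indicator_iff less_top[symmetric])
    fix \<omega> assume \<omega>: "\<omega> \<in> space M"
    show "norm (cis (t \<bullet> Y \<omega>) - cis (t \<bullet> Z \<omega>)) \<le> norm t * r + 2 * indicator (space M - E) \<omega>"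
    proof (cases "\<omega> \<in> E")
      case True
      have "norm (cis (t \<bullet> Y \<omega>) - cis (t \<bullet> Z \<omega>)) \<le> \<bar>t \<bullet> (Y \<omega> - Z \<omega>)\<bar>"
        using norm_cis_diff_le by (simp add: inner_diff_right)
      also have "\<dots> \<le> norm t * norm (Y \<omega> - Z \<omega>)" by (rule Cauchy_Schwarz_ineq2)
      also have "\<dots> \<le> norm t * r" using r(2)[OF True] by (intro mult_left_mono) auto
      finally show ?thesis using True by simp
    next
      case False
      have "norm (cis (t \<bullet> Y \<omega>) - cis (t \<bullet> Z \<omega>)) \<le> 2"
        using norm_triangle_ineq4[of "cis (t \<bullet> Y \<omega>)" "cis (t \<bullet> Z \<omega>)"] by simp
      then show ?thesis using False \<omega> r(1) by (simp add: add_increasing)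
    qed
  qed
  also have "\<dots> = norm t * r + 2 * prob (space M - E)" using E' by (simp add: prob_space less_top[symmetric])
  finally show ?thesis .
qed

section \<open>A central limit theorem for weighted sums\<close>

text \<open>Subtracting the mean of n terms, times n / (n + 1), from the mean of n + 1 terms
  isolates the last term, and both quantities converge to \<open>l\<close>.\<close>

lemma tendsto_last_term_of_convergent_mean:
  fixes s :: "nat \<Rightarrow> real"
  assumes "(\<lambda>n. (\<Sum>i=1..n. s i) / real n) \<longlonglongrightarrow> l"
  shows "(\<lambda>n. s n / real n) \<longlonglongrightarrow> 0"
proof (rule LIMSEQ_imp_Suc)
  have "(\<lambda>n. (\<Sum>i=1..Suc n. s i) / real (Suc n) - (\<Sum>i=1..n. s i) / real n * (real n / real (Suc n)))
    \<longlonglongrightarrow> l - l * 1"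
    by (intro tendsto_intros LIMSEQ_Suc[OF assms] assms LIMSEQ_n_over_Suc_n)
  moreover have "(\<Sum>i=1..Suc n. s i) / real (Suc n) - (\<Sum>i=1..n. s i) / real n * (real n / real (Suc n))
    = s (Suc n) / real (Suc n)" for n
    by (cases "n = 0") (simp_all add: add_divide_distrib del: of_nat_Suc)
  ultimately show "(\<lambda>n. s (Suc n) / real (Suc n)) \<longlonglongrightarrow> 0" by simp
qed

text \<open>Indices beyond a fixed \<open>N\<close> satisfy s i \<le> d i \<le> d n; the finitely
  many others are absorbed by taking n large. Applied to the squared row norms of the design, this
  supplies the negligible weights for the central limit theorem.\<close>

lemma eventually_all_le_of_convergent_mean:
  fixes s :: "nat \<Rightarrow> real"
  assumes lim: "(\<lambda>n. (\<Sum>i=1..n. s i) / real n) \<longlonglongrightarrow> l" and nn: "\<And>i. 0 \<le> s i" and d: "0 < d"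
  shows "\<forall>\<^sub>F n in sequentially. \<forall>i\<in>{1..n}. s i \<le> d * real n"
proof -
  from order_tendstoD(2)[OF tendsto_last_term_of_convergent_mean[OF lim] d]
  obtain N where N: "\<And>i. i \<ge> N \<Longrightarrow> s i / real i < d" by (auto simp: eventually_sequentially)
  have "\<forall>\<^sub>F n in sequentially. real n \<ge> (\<Sum>i\<le>N. s i) / d"
    by (rule filterlim_real_sequentially[THEN filterlim_at_top[THEN iffD1], rule_format])
  then show ?thesis
  proof eventually_elim
    case (elim n)
    show ?case
    proof
      fix i assume i: "i \<in> {1..n}"
      show "s i \<le> d * real n"
      proof (cases "i \<le> N")
        case True
        then have "s i \<le> (\<Sum>i\<le>N. s i)" using nn by (intro member_le_sum) auto
        also have "\<dots> \<le> d * real n" using elim d by (simp add: divide_le_eq mult.commute)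
        finally show ?thesis .
      next
        case False
        then have "s i \<le> d * real i" using N[of i] i by (simp add: divide_less_eq)
        also have "\<dots> \<le> d * real n" using i d by simp
        finally show ?thesis .
      qed
    qed
  qed
qed

lemma exp_minus_approx:
  fixes y :: real
  assumes "0 \<le> y" shows "\<bar>exp (- y) - (1 - y)\<bar> \<le> y\<^sup>2"
proof -
  have 1: "1 - y \<le> exp (- y)" using exp_ge_add_one_self[of "- y"] by simp
  have "exp (- y) \<le> 1 / (1 + y)"
    using exp_ge_add_one_self[of y] assms by (simp add: exp_minus field_simps)
  also have "\<dots> \<le> 1 - y + y\<^sup>2" using assms by (simp add: field_simps power2_eq_square)
  finally show ?thesis using 1 by simp
qed

text \<open>A Lindeberg-type central limit theorem for weighted sums of one i.i.d. sequence, where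
  asymptotic negligibility of the weights replaces the Lindeberg condition.\<close>
lemma (in prob_space) cf_weighted_sum_tendsto:
  fixes X :: "nat \<Rightarrow> 'a \<Rightarrow> real" and a :: "nat \<Rightarrow> nat \<Rightarrow> real"
  assumes indep: "indep_vars (\<lambda>_. borel) X {1..}"
    and distr: "\<And>i. i \<ge> 1 \<Longrightarrow> distr M borel (X i) = distr M borel (X 1)"
    and int: "integrable M (X 1)" "integrable M (\<lambda>\<omega>. (X 1 \<omega>)\<^sup>2)"
    and mean: "expectation (X 1) = 0" and var: "expectation (\<lambda>\<omega>. (X 1 \<omega>)\<^sup>2) = \<sigma>\<^sup>2"
    and v: "(\<lambda>n. \<Sum>i=1..n. (a n i)\<^sup>2) \<longlonglongrightarrow> v"
    and small: "\<And>d. 0 < d \<Longrightarrow> \<forall>\<^sub>F n in sequentially. \<forall>i\<in>{1..n}. \<bar>a n i\<bar> \<le> d"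
  shows "(\<lambda>n. LINT \<omega>|M. cis (\<Sum>i=1..n. a n i * X i \<omega>)) \<longlonglongrightarrow> complex_of_real (exp (- (\<sigma>\<^sup>2 * v) / 2))"
proof -
  have rv[measurable]: "X i \<in> borel_measurable M" if "i \<ge> 1" for i
    using indep that by (auto simp: indep_vars_def2)
  define \<phi> where "\<phi> = char (distr M borel (X 1))"
  \<comment> \<open>\<open>h\<close> is the remainder in the second-order expansion of
    \<open>\<phi>\<close>. The minimum keeps it finite with second moments only, and it vanishes as
    \<open>m\<close> tends to 0.\<close>
  define h where "h = (\<lambda>m. expectation (\<lambda>\<omega>. min (6 * (X 1 \<omega>)\<^sup>2) (m * \<bar>X 1 \<omega>\<bar> ^ 3)))"
  interpret D: real_distribution "distr M borel (X 1)"
    by (rule real_distribution_distr) (simp add: rv)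
  have \<phi>1: "norm (\<phi> t) \<le> 1" for t unfolding \<phi>_def by (rule D.cmod_char_le_1)
  have approx: "norm (\<phi> t - (1 - t\<^sup>2 * \<sigma>\<^sup>2 / 2)) \<le> t\<^sup>2 / 6 * h \<bar>t\<bar>" for t
    unfolding \<phi>_def h_def
    by (rule char_approx3'[where \<mu>="distr M borel (X 1)"]) (use rv int mean var in simp_all)
  have [measurable]: "X (Suc 0) \<in> borel_measurable M" using rv[of 1] by simp
  have int_h: "integrable M (\<lambda>\<omega>. min (6 * (X 1 \<omega>)\<^sup>2) (m * \<bar>X 1 \<omega>\<bar> ^ 3))" if "0 \<le> m" for m
    by (rule Bochner_Integration.integrable_bound[of M "\<lambda>\<omega>. 6 * (X 1 \<omega>)\<^sup>2"]) (use int that in auto)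
  have h_mono: "h m \<le> h m'" if "0 \<le> m" "m \<le> m'" for m m'
    unfolding h_def using that
    by (intro integral_mono int_h min.mono mult_right_mono) auto
  have h_nn: "0 \<le> h m" if "0 \<le> m" for m
    unfolding h_def using that by (intro Bochner_Integration.integral_nonneg) auto
  \<comment> \<open>Dominated convergence needs a sequence; \<open>h_mono\<close> later carries
    smallness at 1 / (k + 1) over to all smaller arguments.\<close>
  have h_lim: "(\<lambda>k. h (1 / real (Suc k))) \<longlonglongrightarrow> 0"
  proof -
    have "(\<lambda>k. h (1 / real (Suc k))) \<longlonglongrightarrow> expectation (\<lambda>\<omega>. 0)"
      unfolding h_def
    proof (rule integral_dominated_convergence[where w="\<lambda>\<omega>. 6 * (X 1 \<omega>)\<^sup>2"])
      show "AE \<omega> in M. (\<lambda>k. min (6 * (X 1 \<omega>)\<^sup>2) (1 / real (Suc k) * \<bar>X 1 \<omega>\<bar> ^ 3)) \<longlonglongrightarrow> 0"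
      proof (rule AE_I2)
        fix \<omega>
        have "(\<lambda>k. min (6 * (X 1 \<omega>)\<^sup>2) (1 / real (Suc k) * \<bar>X 1 \<omega>\<bar> ^ 3)) \<longlonglongrightarrow> min (6 * (X 1 \<omega>)\<^sup>2) (0 * \<bar>X 1 \<omega>\<bar> ^ 3)"
          by (intro tendsto_intros) (use LIMSEQ_inverse_real_of_nat in \<open>simp add: inverse_eq_divide\<close>)
        then show "(\<lambda>k. min (6 * (X 1 \<omega>)\<^sup>2) (1 / real (Suc k) * \<bar>X 1 \<omega>\<bar> ^ 3)) \<longlonglongrightarrow> 0" by simp
      qed
    qed (use int in auto)
    then show ?thesis by simp
  qed
  have cf: "(LINT \<omega>|M. cis (\<Sum>i=1..n. a n i * X i \<omega>)) = (\<Prod>i=1..n. \<phi> (a n i))" for n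
  proof -
    have ind: "indep_vars (\<lambda>_. borel) (\<lambda>i \<omega>. a n i * X i \<omega>) {1..n}"
      by (rule indep_vars_compose2[OF indep_vars_subset[OF indep]]) auto
    have "(LINT \<omega>|M. cis (\<Sum>i=1..n. a n i * X i \<omega>)) = char (distr M borel (\<lambda>\<omega>. \<Sum>i=1..n. a n i * X i \<omega>)) 1"
      unfolding char_def by (subst integral_distr) (auto simp: cis_conv_exp rv)
    also have "\<dots> = (\<Prod>i=1..n. char (distr M borel (\<lambda>\<omega>. a n i * X i \<omega>)) 1)"
      by (rule char_distr_sum[OF ind])
    also have "\<dots> = (\<Prod>i=1..n. \<phi> (a n i))"
    proof (rule prod.cong[OF refl])
      fix i assume "i \<in> {1..n}"
      then have i: "i \<ge> 1" by simp
      note [measurable] = rv[OF i]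
      have "char (distr M borel (\<lambda>\<omega>. a n i * X i \<omega>)) 1 = char (distr M borel (X i)) (a n i)"
        unfolding char_def by (simp add: integral_distr)
      then show "char (distr M borel (\<lambda>\<omega>. a n i * X i \<omega>)) 1 = \<phi> (a n i)"
        by (simp add: \<phi>_def distr[OF i])
    qed
    finally show ?thesis .
  qed
  \<comment> \<open>The characteristic function of a centered Gaussian with variance \<sigma>^2.
    Comparing factor by factor avoids complex logarithms.\<close>
  define g where "g = (\<lambda>t. complex_of_real (exp (- (t\<^sup>2 * \<sigma>\<^sup>2 / 2))))"
  have g1: "norm (g t) \<le> 1" for t unfolding g_def norm_of_real by simp
  have \<phi>g: "norm (\<phi> t - g t) \<le> t\<^sup>2 * (h d + d\<^sup>2 * \<sigma>^4)" if "\<bar>t\<bar> \<le> d" for t d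
  proof -
    have d: "0 \<le> d" using that by linarith
    have "g t - (1 - t\<^sup>2 * \<sigma>\<^sup>2 / 2) = of_real (exp (- (t\<^sup>2 * \<sigma>\<^sup>2 / 2)) - (1 - t\<^sup>2 * \<sigma>\<^sup>2 / 2))"
      by (simp add: g_def)
    then have "norm (g t - (1 - t\<^sup>2 * \<sigma>\<^sup>2 / 2)) \<le> (t\<^sup>2 * \<sigma>\<^sup>2 / 2)\<^sup>2"
      by (simp only: norm_of_real) (rule exp_minus_approx, simp)
    also have "\<dots> \<le> t\<^sup>2 * (d\<^sup>2 * \<sigma>^4)"
    proof -
      have "t\<^sup>2 \<le> d\<^sup>2" using that d by (metis abs_le_square_iff abs_of_nonneg)
      then have "t\<^sup>2 * t\<^sup>2 * \<sigma>^4 \<le> t\<^sup>2 * d\<^sup>2 * \<sigma>^4" by (intro mult_right_mono mult_left_mono) auto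
      moreover have "(t\<^sup>2 * \<sigma>\<^sup>2 / 2)\<^sup>2 = (t\<^sup>2 * t\<^sup>2 * \<sigma>^4) / 4" by (simp add: power2_eq_square power4_eq_xxxx)
      moreover have "0 \<le> t\<^sup>2 * t\<^sup>2 * \<sigma>^4" by simp
      ultimately have "(t\<^sup>2 * \<sigma>\<^sup>2 / 2)\<^sup>2 \<le> t\<^sup>2 * d\<^sup>2 * \<sigma>^4" by linarith
      then show ?thesis by (simp only: mult.assoc)
    qed
    finally have 1: "norm (g t - (1 - t\<^sup>2 * \<sigma>\<^sup>2 / 2)) \<le> t\<^sup>2 * (d\<^sup>2 * \<sigma>^4)" .
    have "norm (\<phi> t - (1 - t\<^sup>2 * \<sigma>\<^sup>2 / 2)) \<le> t\<^sup>2 / 6 * h \<bar>t\<bar>" by (rule approx)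
    also have "\<dots> \<le> t\<^sup>2 * h d" using h_mono[of "\<bar>t\<bar>" d] h_nn[of "\<bar>t\<bar>"] that by (intro mult_mono) auto
    finally have 2: "norm (\<phi> t - (1 - t\<^sup>2 * \<sigma>\<^sup>2 / 2)) \<le> t\<^sup>2 * h d" .
    have "norm (\<phi> t - g t) \<le> norm (\<phi> t - (1 - t\<^sup>2 * \<sigma>\<^sup>2 / 2)) + norm (g t - (1 - t\<^sup>2 * \<sigma>\<^sup>2 / 2))"
      by (metis norm_triangle_ineq4 diff_diff_eq2 diff_add_cancel add_diff_cancel_right)
    with 1 2 show ?thesis by (simp add: distrib_left)
  qed
  have prod_g: "(\<Prod>i=1..n. g (a n i)) = complex_of_real (exp (- (\<sigma>\<^sup>2 * (\<Sum>i=1..n. (a n i)\<^sup>2)) / 2))" for n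
    by (simp add: g_def flip: of_real_prod exp_sum)
       (simp add: sum_negf sum_divide_distrib sum_distrib_left mult.commute)
  have "(\<lambda>n. (\<Prod>i=1..n. \<phi> (a n i)) - (\<Prod>i=1..n. g (a n i))) \<longlonglongrightarrow> 0"
  proof (rule tendstoI)
    fix r :: real assume r: "0 < r"
    have v0: "0 \<le> v" by (rule LIMSEQ_le_const[OF v]) (blast intro: sum_nonneg zero_le_power2)
    have "(\<lambda>k. h (1 / real (Suc k)) + (1 / real (Suc k))\<^sup>2 * \<sigma>^4) \<longlonglongrightarrow> 0 + 0\<^sup>2 * \<sigma>^4"
      by (intro tendsto_intros h_lim) (use LIMSEQ_inverse_real_of_nat in \<open>simp add: inverse_eq_divide\<close>)
    then have "(\<lambda>k. h (1 / real (Suc k)) + (1 / real (Suc k))\<^sup>2 * \<sigma>^4) \<longlonglongrightarrow> 0" by simp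
    \<comment> \<open>The squared weights eventually sum to less than v + 1, so an error of r / (v +
      1) per unit of squared weight stays below \<open>r\<close> in total.\<close>
    from order_tendstoD(2)[OF this, of "r / (v + 1)"] r v0
    obtain k where k: "h (1 / real (Suc k)) + (1 / real (Suc k))\<^sup>2 * \<sigma>^4 < r / (v + 1)"
      by (auto simp: eventually_sequentially)
    define d where "d = 1 / real (Suc k)"
    have d: "0 < d" "h d + d\<^sup>2 * \<sigma>^4 < r / (v + 1)" using k by (auto simp: d_def)
    have hd: "0 \<le> h d + d\<^sup>2 * \<sigma>^4" using h_nn[of d] d by simp
    show "\<forall>\<^sub>F n in sequentially. dist ((\<Prod>i=1..n. \<phi> (a n i)) - (\<Prod>i=1..n. g (a n i))) 0 < r"
      using small[OF d(1)] order_tendstoD(2)[OF v, of "v + 1", simplified]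
    proof eventually_elim
      case (elim n)
      \<comment> \<open>All factors have modulus at most 1, so the products differ by no more than
        the sum of the differences of the factors.\<close>
      have "norm ((\<Prod>i=1..n. \<phi> (a n i)) - (\<Prod>i=1..n. g (a n i))) \<le> (\<Sum>i=1..n. norm (\<phi> (a n i) - g (a n i)))"
        by (rule norm_prod_diff) (use \<phi>1 g1 in auto)
      also have "\<dots> \<le> (\<Sum>i=1..n. (a n i)\<^sup>2 * (h d + d\<^sup>2 * \<sigma>^4))"
        by (rule sum_mono) (use elim(1) \<phi>g in auto)
      also have "\<dots> = (\<Sum>i=1..n. (a n i)\<^sup>2) * (h d + d\<^sup>2 * \<sigma>^4)" by (simp add: sum_distrib_right)
      also have "\<dots> \<le> (v + 1) * (h d + d\<^sup>2 * \<sigma>^4)" using elim(2) hd by (intro mult_right_mono) auto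
      also have "\<dots> < r" using d(2) v0 by (simp add: less_divide_eq mult.commute)
      finally show ?case by simp
    qed
  qed
  moreover have "(\<lambda>n. \<Prod>i=1..n. g (a n i)) \<longlonglongrightarrow> complex_of_real (exp (- (\<sigma>\<^sup>2 * v) / 2))"
    unfolding prod_g by (intro tendsto_intros v) simp
  ultimately have "(\<lambda>n. ((\<Prod>i=1..n. \<phi> (a n i)) - (\<Prod>i=1..n. g (a n i))) + (\<Prod>i=1..n. g (a n i)))
    \<longlonglongrightarrow> 0 + complex_of_real (exp (- (\<sigma>\<^sup>2 * v) / 2))" by (intro tendsto_add)
  then show ?thesis unfolding cf by simp
qed

text \<open>Expanding the square gives a double sum whose off-diagonal terms vanish by independence
  and zero means. The tightness of the score rests on this moment.\<close>

lemma (in prob_space) expectation_norm_weighted_sum: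
  fixes X :: "nat \<Rightarrow> 'a \<Rightarrow> real" and x :: "nat \<Rightarrow> 'b::euclidean_space"
  assumes indep: "indep_vars (\<lambda>_. borel) X I" and I: "finite I"
    and int: "\<And>i. i \<in> I \<Longrightarrow> integrable M (X i)" "\<And>i. i \<in> I \<Longrightarrow> integrable M (\<lambda>\<omega>. (X i \<omega>)\<^sup>2)"
    and mean: "\<And>i. i \<in> I \<Longrightarrow> expectation (X i) = 0"
    and var: "\<And>i. i \<in> I \<Longrightarrow> expectation (\<lambda>\<omega>. (X i \<omega>)\<^sup>2) = \<sigma>\<^sup>2"
  shows "integrable M (\<lambda>\<omega>. (norm (\<Sum>i\<in>I. X i \<omega> *\<^sub>R x i))\<^sup>2)"
    and "expectation (\<lambda>\<omega>. (norm (\<Sum>i\<in>I. X i \<omega> *\<^sub>R x i))\<^sup>2) = \<sigma>\<^sup>2 * (\<Sum>i\<in>I. (norm (x i))\<^sup>2)"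
proof -
  have eq: "(norm (\<Sum>i\<in>I. X i \<omega> *\<^sub>R x i))\<^sup>2 = (\<Sum>i\<in>I. \<Sum>j\<in>I. (X i \<omega> * X j \<omega>) * (x i \<bullet> x j))" for \<omega>
    by (simp add: power2_norm_eq_inner inner_sum_left inner_sum_right inner_commute mult_ac)
  have prod: "integrable M (\<lambda>\<omega>. X i \<omega> * X j \<omega>) \<and> expectation (\<lambda>\<omega>. X i \<omega> * X j \<omega>) = (if i = j then \<sigma>\<^sup>2 else 0)"
    if "i \<in> I" "j \<in> I" for i j
  proof (cases "i = j")
    case True
    then show ?thesis using int(2)[OF that(1)] var[OF that(1)] by (simp add: power2_eq_square)
  next
    case False
    have ind: "indep_vars (\<lambda>_. borel) X {i, j}" by (rule indep_vars_subset[OF indep]) (use that in auto)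
    have "integrable M (\<lambda>\<omega>. \<Prod>k\<in>{i, j}. X k \<omega>)" "expectation (\<lambda>\<omega>. \<Prod>k\<in>{i, j}. X k \<omega>) = (\<Prod>k\<in>{i, j}. expectation (X k))"
      by (rule indep_vars_integrable[OF _ ind] indep_vars_lebesgue_integral[OF _ ind], use that int in auto)+
    then show ?thesis using False mean that by simp
  qed
  show "integrable M (\<lambda>\<omega>. (norm (\<Sum>i\<in>I. X i \<omega> *\<^sub>R x i))\<^sup>2)"
    unfolding eq using prod by (intro Bochner_Integration.integrable_sum integrable_mult_left) auto
  have "expectation (\<lambda>\<omega>. (norm (\<Sum>i\<in>I. X i \<omega> *\<^sub>R x i))\<^sup>2)
    = (\<Sum>i\<in>I. \<Sum>j\<in>I. expectation (\<lambda>\<omega>. X i \<omega> * X j \<omega>) * (x i \<bullet> x j))"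
    unfolding eq using prod
    by (simp add: Bochner_Integration.integral_sum Bochner_Integration.integrable_sum cong: sum.cong)
  also have "\<dots> = (\<Sum>i\<in>I. \<Sum>j\<in>I. if i = j then \<sigma>\<^sup>2 * (x i \<bullet> x i) else 0)"
    using prod by (intro sum.cong) auto
  also have "\<dots> = \<sigma>\<^sup>2 * (\<Sum>i\<in>I. (norm (x i))\<^sup>2)"
    using I by (simp add: sum_distrib_left power2_norm_eq_inner)
  finally show "expectation (\<lambda>\<omega>. (norm (\<Sum>i\<in>I. X i \<omega> *\<^sub>R x i))\<^sup>2) = \<sigma>\<^sup>2 * (\<Sum>i\<in>I. (norm (x i))\<^sup>2)" .
qed

section \<open>Gaussian laws and the embedded inverse of a principal submatrix\<close>

lemma matrix_vector_mult_sum_components: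
  fixes S :: "real^'n^'n"
  shows "v \<bullet> (S *v w) = (\<Sum>i\<in>UNIV. \<Sum>j\<in>UNIV. v $ i * S $ i $ j * w $ j)"
  by (simp add: inner_vec_def matrix_vector_mult_def sum_distrib_left mult.assoc)

lemma symmetric_matrix_inner:
  fixes S :: "real^'n^'n"
  assumes "transpose S = S" shows "v \<bullet> (S *v w) = w \<bullet> (S *v v)"
  by (metis assms dot_lmul_matrix inner_commute transpose_matrix_vector)

lemma gaussian_law_zero: "\<exists>\<mu>. gaussian_law (0 :: real^'n^'n) \<mu>"
proof
  have [measurable]: "cis \<in> borel_measurable borel"
    by (intro borel_measurable_continuous_onI continuous_intros)
  have "(LINT x|return borel 0. cis (t \<bullet> x)) = cis (t \<bullet> 0)" for t :: "real^'n"
    by (rule integral_return) auto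
  then show "gaussian_law (0 :: real^'n^'n) (return borel 0)"
    by (simp add: gaussian_law_def prob_space_return)
qed

text \<open>If G has law \<open>\<mu>\<close> and N is an independent standard normal variable, G +
  N v has the required law: N contributes the factor exp (- (v . t)^2 / 2) to the characteristic
  function.\<close>

lemma gaussian_law_add_rank1:
  fixes S :: "real^'n^'n"
  assumes \<mu>: "gaussian_law S \<mu>"
    and S': "\<And>t. t \<bullet> (S' *v t) = t \<bullet> (S *v t) + (v \<bullet> t)\<^sup>2"
  shows "\<exists>\<mu>. gaussian_law S' \<mu>"
proof -
  interpret \<mu>: prob_space \<mu> using \<mu> by (simp add: gaussian_law_def)
  have sets[measurable_cong, simp]: "sets \<mu> = sets borel" using \<mu> by (simp add: gaussian_law_def)
  interpret N: real_distribution std_normal_distribution by (rule real_dist_normal_dist)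
  interpret P: pair_prob_space \<mu> std_normal_distribution by unfold_locales
  define f where "f = (\<lambda>p::(real^'n)\<times>real. fst p + snd p *\<^sub>R v)"
  have f[measurable]: "f \<in> borel_measurable (\<mu> \<Otimes>\<^sub>M std_normal_distribution)" unfolding f_def by measurable
  have cf: "(LINT x|distr (\<mu> \<Otimes>\<^sub>M std_normal_distribution) borel f. cis (t \<bullet> x))
     = complex_of_real (exp (- (t \<bullet> (S' *v t)) / 2))" for t
  proof -
    have [measurable]: "cis \<in> borel_measurable borel"
      by (intro borel_measurable_continuous_onI continuous_intros)
    have eq: "cis (t \<bullet> f p) = cis (t \<bullet> fst p) * cis (snd p * (t \<bullet> v))" for p
      by (simp add: f_def cis_mult inner_add_right)
    have "(LINT x|distr (\<mu> \<Otimes>\<^sub>M std_normal_distribution) borel f. cis (t \<bullet> x))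
      = (LINT p|(\<mu> \<Otimes>\<^sub>M std_normal_distribution). cis (t \<bullet> f p))"
      by (rule integral_distr) measurable
    also have "\<dots> = (LINT x|\<mu>. LINT y|std_normal_distribution. cis (t \<bullet> f (x, y)))"
    proof (rule P.integral_fst'[symmetric])
      show "integrable (\<mu> \<Otimes>\<^sub>M std_normal_distribution) (\<lambda>p. cis (t \<bullet> f p))"
        by (rule P.P.integrable_const_bound[of _ 1]) auto
    qed
    also have "\<dots> = (LINT x|\<mu>. cis (t \<bullet> x)) * (LINT y|std_normal_distribution. cis (y * (t \<bullet> v)))"
      by (simp add: eq)
    also have "(LINT y|std_normal_distribution. cis (y * (t \<bullet> v))) = char std_normal_distribution (t \<bullet> v)"
      by (simp add: char_def cis_conv_exp mult.commute)
    also have "\<dots> = complex_of_real (exp (- (t \<bullet> v)\<^sup>2 / 2))" by (simp add: char_std_normal_distribution)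
    also have "(LINT x|\<mu>. cis (t \<bullet> x)) = complex_of_real (exp (- (t \<bullet> (S *v t)) / 2))"
      using \<mu> by (simp add: gaussian_law_def)
    finally show ?thesis
      by (simp add: S' inner_commute[of v t] add_divide_distrib diff_divide_distrib flip: of_real_mult exp_add)
  qed
  have "gaussian_law S' (distr (\<mu> \<Otimes>\<^sub>M std_normal_distribution) borel f)"
    unfolding gaussian_law_def using cf by (auto intro!: P.P.prob_space_distr)
  then show ?thesis by blast
qed

text \<open>Induction over the set of nonzero rows: passing to the Schur complement of a positive diagonal
  entry kills its row and changes the quadratic form by the square of a linear form.\<close>
lemma gaussian_law_exists_aux:
  fixes S :: "real^'n^'n"
  assumes "finite F" "transpose S = S" "\<And>t. 0 \<le> t \<bullet> (S *v t)" "\<And>i j. i \<notin> F \<Longrightarrow> S $ i $ j = 0"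
  shows "\<exists>\<mu>. gaussian_law S \<mu>"
  using assms
proof (induction F arbitrary: S rule: finite_induct)
  case empty
  then have "S = 0" by (simp add: vec_eq_iff)
  then show ?case using gaussian_law_zero by simp
next
  case (insert k F)
  note psd = insert.prems(2)
  have sym: "S $ i $ j = S $ j $ i" for i j
    using insert.prems(1) by (metis transpose_def vec_lambda_beta)
  define e where "e = (axis k 1 :: real^'n)"
  define a where "a = S $ k $ k"
  define r where "r = S *v e"
  have r: "r $ i = S $ i $ k" for i
    by (simp add: r_def e_def matrix_vector_mult_basis column_def)
  have er: "e \<bullet> r = a" by (simp add: e_def inner_axis' r a_def)
  have tr: "e \<bullet> (S *v t) = r \<bullet> t" for t
    unfolding r_def using symmetric_matrix_inner[OF insert.prems(1)] by (simp add: inner_commute)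
  \<comment> \<open>The form at \<open>t + c *\<^sub>R e\<close> is a polynomial in \<open>c\<close>
    that is never negative. Both cases below exploit the free choice of \<open>c\<close>.\<close>
  have quad: "0 \<le> t \<bullet> (S *v t) + 2 * c * (r \<bullet> t) + c\<^sup>2 * a" for t c
  proof -
    have "(t + c *\<^sub>R e) \<bullet> (S *v (t + c *\<^sub>R e)) = t \<bullet> (S *v t) + 2 * c * (r \<bullet> t) + c\<^sup>2 * a"
      using tr[of t] er symmetric_matrix_inner[OF insert.prems(1), of t e]
      by (simp add: matrix_vector_right_distrib matrix_vector_mult_scaleR inner_add_left inner_add_right
          power2_eq_square algebra_simps flip: r_def)
    then show ?thesis using psd by metis
  qed
  show ?case
  proof (cases "a = 0")
    case True
    have rt: "r \<bullet> t = 0" for t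
    proof (rule ccontr)
      assume ne: "r \<bullet> t \<noteq> 0"
      \<comment> \<open>With a = 0 the polynomial is affine in \<open>c\<close>, and a nonzero slope
        lets it reach -1.\<close>
      define c where "c = - (t \<bullet> (S *v t) + 1) / (2 * (r \<bullet> t))"
      have "2 * c * (r \<bullet> t) = - (t \<bullet> (S *v t) + 1)" using ne by (simp add: c_def field_simps)
      then show False using quad[of t c] True by simp
    qed
    have "r = 0" using rt[of r] by simp
    then have "S $ i $ k = 0" for i using r[of i] by simp
    then have "S $ k $ j = 0" for j using sym by metis
    then have "S $ i $ j = 0" if "i \<notin> F" for i j
      using insert.prems(3)[of i j] that by (cases "i = k") auto
    with insert.prems(1,2) show ?thesis by (intro insert.IH)
  next
    case False
    have "0 \<le> a" using psd[of e] er by (simp add: r_def)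
    with False have a: "0 < a" by simp
    \<comment> \<open>The Schur complement. Its form at \<open>t\<close> is the minimum of the
      polynomial in \<open>quad\<close>, attained at c = - (r . t) / a, hence nonnegative.\<close>
    define S' where "S' = (\<chi> i j. S $ i $ j - r $ i * r $ j / a)"
    have S'q: "t \<bullet> (S' *v t) = t \<bullet> (S *v t) - (r \<bullet> t)\<^sup>2 / a" for t
    proof -
      have "t \<bullet> (S' *v t) = (\<Sum>i\<in>UNIV. \<Sum>j\<in>UNIV. t $ i * S $ i $ j * t $ j - (r $ i * t $ i) * (r $ j * t $ j) / a)"
        unfolding matrix_vector_mult_sum_components by (simp add: S'_def algebra_simps)
      also have "\<dots> = t \<bullet> (S *v t) - (r \<bullet> t)\<^sup>2 / a"
        unfolding matrix_vector_mult_sum_components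
        by (simp add: sum_subtractf inner_vec_def power2_eq_square sum_product sum_divide_distrib)
      finally show ?thesis .
    qed
    have "\<exists>\<mu>. gaussian_law S' \<mu>"
    proof (rule insert.IH)
      show "transpose S' = S'" by (simp add: transpose_def S'_def vec_eq_iff sym mult.commute)
      show "0 \<le> t \<bullet> (S' *v t)" for t
        using quad[of t "- (r \<bullet> t) / a"] a unfolding S'q by (simp add: power2_eq_square field_simps)
      show "S' $ i $ j = 0" if "i \<notin> F" for i j
      proof (cases "i = k")
        case True
        then show ?thesis using a by (simp add: S'_def r a_def[symmetric] sym)
      next
        case False
        then show ?thesis using that insert.prems(3) by (simp add: S'_def r)
      qed
    qed
    then obtain \<mu> where "gaussian_law S' \<mu>" by blast
    moreover have "t \<bullet> (S *v t) = t \<bullet> (S' *v t) + (((1 / sqrt a) *\<^sub>R r) \<bullet> t)\<^sup>2" for t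
      using a by (simp add: S'q power_divide)
    ultimately show ?thesis by (rule gaussian_law_add_rank1)
  qed
qed

lemma gaussian_law_exists:
  fixes S :: "real^'n^'n"
  assumes "transpose S = S" "\<And>t. 0 \<le> t \<bullet> (S *v t)"
  shows "\<exists>\<mu>. gaussian_law S \<mu>"
  by (rule gaussian_law_exists_aux[of UNIV]) (use assms in auto)

text \<open>A kernel vector of \<open>B\<close> vanishes off \<open>A\<close>, where
  \<open>B\<close> acts as the identity, and its image under \<open>C\<close> vanishes on
  \<open>A\<close>. Hence v . C v = 0, and positive definiteness forces v = 0.\<close>

lemma invertible_block_of_pos_def_mat:
  fixes C :: "real^'n^'n" and A :: "'n set"
  assumes "pos_def_mat C"
  defines "B \<equiv> (\<chi> i j. if i \<in> A \<and> j \<in> A then C $ i $ j else if i = j then 1 else 0)"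
  shows "invertible B"
proof -
  have "v = 0" if v: "B *v v = 0" for v
  proof -
    have Bv: "(B *v v) $ i = (if i \<in> A then (C *v restrict_vec A v) $ i else v $ i)" for i
    proof (cases "i \<in> A")
      case True
      then show ?thesis
        by (auto simp: B_def matrix_vector_mult_def restrict_vec_def intro!: sum.cong)
    next
      case False
      then show ?thesis
        by (simp add: B_def matrix_vector_mult_def if_distrib[of "\<lambda>x. x * _"] cong: if_cong)
    qed
    have 0: "v $ i = 0" if "i \<notin> A" for i using Bv[of i] v that by simp
    then have r: "restrict_vec A v = v" by (simp add: restrict_vec_def vec_eq_iff)
    have "(C *v v) $ i = 0" if "i \<in> A" for i using Bv[of i] v that r by simp
    with 0 have z: "v $ i * (C *v v) $ i = 0" for i by (cases "i \<in> A") auto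
    have "v \<bullet> (C *v v) = 0" by (simp only: inner_vec_def inner_real_def z sum.neutral_const)
    then show ?thesis using assms(1) unfolding pos_def_mat_def by (metis less_irrefl)
  qed
  then show ?thesis using matrix_left_invertible_ker invertible_left_inverse by blast
qed

text \<open>Off \<open>A\<close> the system B z = \<open>restrict_vec A w\<close> forces z to
  vanish, and on \<open>A\<close> it then reads (C z) j = w j. Later arguments rely on these two
  facts and not on the formula for the inverse.\<close>

lemma sub_inv_embed_mult:
  fixes C :: "real^'n^'n"
  assumes "pos_def_mat C"
  shows sub_inv_embed_supp: "j \<notin> A \<Longrightarrow> (sub_inv_embed A C *v w) $ j = 0"
    and mult_sub_inv_embed: "j \<in> A \<Longrightarrow> (C *v (sub_inv_embed A C *v w)) $ j = w $ j"
proof -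
  define B where "B = (\<chi> i j. if i \<in> A \<and> j \<in> A then C $ i $ j else if i = j then 1 else 0)"
  define z where "z = matrix_inv B *v restrict_vec A w"
  have "invertible B" unfolding B_def by (rule invertible_block_of_pos_def_mat[OF assms])
  then have "B ** matrix_inv B = mat 1"
    unfolding matrix_inv_def invertible_def by (rule someI2_ex) simp
  then have Bz: "B *v z = restrict_vec A w" by (simp add: z_def matrix_vector_mul_assoc)
  have z0: "z $ i = 0" if "i \<notin> A" for i
  proof -
    have "(B *v z) $ i = z $ i" using that
      by (simp add: B_def matrix_vector_mult_def if_distrib[of "\<lambda>x. x * _"] cong: if_cong)
    then show ?thesis using Bz that by (simp add: restrict_vec_def)
  qed
  have emb: "sub_inv_embed A C *v w = z"
  proof -
    have "(sub_inv_embed A C *v w) $ i = (if i \<in> A then z $ i else 0)" for i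
      unfolding z_def sub_inv_embed_def Let_def B_def[symmetric]
      by (auto simp: matrix_vector_mult_def restrict_vec_def intro!: sum.cong)
    then show ?thesis using z0 by (auto simp: vec_eq_iff)
  qed
  show "(sub_inv_embed A C *v w) $ j = 0" if "j \<notin> A" using emb z0 that by simp
  show "(C *v (sub_inv_embed A C *v w)) $ j = w $ j" if "j \<in> A"
  proof -
    have "(C *v z) $ j = (B *v z) $ j"
      using that z0 by (auto simp: B_def matrix_vector_mult_def intro!: sum.cong)
    then show ?thesis using Bz emb that by (simp add: restrict_vec_def)
  qed
qed

text \<open>Off \<open>A\<close> the entries of C S w are uncontrolled, but there \<open>v\<close>
  is zero. This is the normal equation of the quadratic restricted to vectors supported on
  \<open>A\<close>.\<close>

lemma inner_mult_sub_inv_embed: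
  fixes C :: "real^'n^'n"
  assumes "pos_def_mat C" "\<And>j. j \<notin> A \<Longrightarrow> v $ j = 0"
  shows "v \<bullet> (C *v (sub_inv_embed A C *v w)) = v \<bullet> w"
  using mult_sub_inv_embed[OF assms(1)] assms(2)
  by (auto simp: inner_vec_def intro!: sum.cong) (metis mult_zero_left)

text \<open>The identity S C S = S in terms of bilinear forms. It turns the limiting covariance
  \<sigma>^2 C of the score into the covariance \<sigma>^2 S of its image under S.\<close>

lemma sub_inv_embed_form:
  fixes C :: "real^'n^'n"
  assumes "pos_def_mat C"
  shows "(sub_inv_embed A C *v t) \<bullet> (C *v (sub_inv_embed A C *v w)) = t \<bullet> (sub_inv_embed A C *v w)"
  using symmetric_matrix_inner[of C] assms inner_mult_sub_inv_embed[OF assms sub_inv_embed_supp[OF assms]]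
  by (metis inner_commute pos_def_mat_def)

lemma sub_inv_embed_inner:
  fixes C :: "real^'n^'n"
  assumes "pos_def_mat C"
  shows "t \<bullet> (sub_inv_embed A C *v w) = (sub_inv_embed A C *v t) \<bullet> w"
  by (metis assms inner_mult_sub_inv_embed sub_inv_embed_form sub_inv_embed_supp)

lemma transpose_sub_inv_embed:
  fixes C :: "real^'n^'n"
  assumes "pos_def_mat C"
  shows "transpose (sub_inv_embed A C) = sub_inv_embed A C"
proof -
  have "sub_inv_embed A C $ i $ j = sub_inv_embed A C $ j $ i" for i j
    using sub_inv_embed_inner[OF assms, of "axis i 1" A "axis j 1"]
    by (simp add: inner_axis inner_axis' matrix_vector_mult_basis column_def)
  then show ?thesis by (simp add: transpose_def vec_eq_iff)
qed

section \<open>Bounds for the rescaled Lasso minimizer\<close>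

lemma norm_matrix_vector_mult_le:
  fixes E :: "real^'n^'m"
  shows "norm (E *v w) \<le> real CARD('m) * norm E * norm w"
proof -
  have "norm (E *v w) \<le> (\<Sum>i\<in>UNIV. \<bar>(E *v w) $ i\<bar>)" by (rule norm_le_l1_cart)
  also have "\<dots> \<le> (\<Sum>i\<in>(UNIV::'m set). norm E * norm w)"
  proof (rule sum_mono)
    fix i
    have "\<bar>(E *v w) $ i\<bar> = \<bar>E $ i \<bullet> w\<bar>" by (simp add: matrix_vector_mult_def inner_vec_def)
    also have "\<dots> \<le> norm (E $ i) * norm w" by (rule Cauchy_Schwarz_ineq2)
    also have "\<dots> \<le> norm E * norm w" by (intro mult_right_mono Finite_Cartesian_Product.norm_nth_le) auto
    finally show "\<bar>(E *v w) $ i\<bar> \<le> norm E * norm w" .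
  qed
  finally show ?thesis by simp
qed

lemma abs_inner_matrix_vector_le:
  fixes E :: "real^'n^'n"
  shows "\<bar>v \<bullet> (E *v w)\<bar> \<le> real CARD('n) * norm E * norm v * norm w"
proof -
  have "\<bar>v \<bullet> (E *v w)\<bar> \<le> norm v * norm (E *v w)" by (rule Cauchy_Schwarz_ineq2)
  also have "\<dots> \<le> norm v * (real CARD('n) * norm E * norm w)"
    by (intro mult_left_mono norm_matrix_vector_mult_le) auto
  finally show ?thesis by (simp add: mult_ac)
qed

text \<open>The constant is the minimum of the form on the compact unit sphere; homogeneity extends
  the bound to all vectors.\<close>

lemma pos_def_mat_coercive:
  fixes C :: "real^'n^'n"
  assumes "pos_def_mat C"
  shows "\<exists>c>0. \<forall>v. c * (norm v)\<^sup>2 \<le> v \<bullet> (C *v v)"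
proof -
  have "continuous_on (sphere 0 1) (\<lambda>v. v \<bullet> (C *v v))"
    by (intro continuous_intros linear_continuous_on bounded_linear.linear matrix_vector_mul_bounded_linear)
  moreover have "axis undefined 1 \<in> (sphere 0 1 :: (real^'n) set)" by simp
  ultimately obtain z where z: "z \<in> sphere 0 1" "\<And>v. v \<in> sphere 0 1 \<Longrightarrow> z \<bullet> (C *v z) \<le> v \<bullet> (C *v v)"
    using continuous_attains_inf[of "sphere 0 1" "\<lambda>v. v \<bullet> (C *v v)"] by fastforce
  have "z \<noteq> 0" using z(1) by auto
  then have "0 < z \<bullet> (C *v z)" using assms by (simp add: pos_def_mat_def)
  moreover have "z \<bullet> (C *v z) * (norm v)\<^sup>2 \<le> v \<bullet> (C *v v)" for v
  proof (cases "v = 0")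
    case False
    define w where "w = (1 / norm v) *\<^sub>R v"
    have "v = norm v *\<^sub>R w" "norm w = 1" using False by (simp_all add: w_def)
    moreover have "(r *\<^sub>R w) \<bullet> (C *v (r *\<^sub>R w)) = r\<^sup>2 * (w \<bullet> (C *v w))" for r
      by (simp add: matrix_vector_mult_scaleR power2_eq_square)
    ultimately have "v \<bullet> (C *v v) = (norm v)\<^sup>2 * (w \<bullet> (C *v w))" by metis
    moreover have "z \<bullet> (C *v z) \<le> w \<bullet> (C *v w)" using z(2) \<open>norm w = 1\<close> by simp
    ultimately show ?thesis by (simp add: mult.commute[of "(norm v)\<^sup>2"] mult_right_mono)
  qed simp
  ultimately show ?thesis by blast
qed

text \<open>The minimizer \<open>u\<close> of the rescaled objective is compared with \<open>0\<close>, with its truncation to the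
  active set \<open>A\<close>, and with the unpenalized minimizer \<open>sub_inv_embed A C *v W\<close> of the limiting
  quadratic on that set.\<close>
lemma lasso_minimizer_bounds:
  fixes C D :: "real^'n^'n" and u W \<beta> :: "real^'n" and \<Lambda> :: "'n \<Rightarrow> real"
  defines "m \<equiv> real CARD('n)"
  assumes min: "\<And>v. u \<bullet> (D *v u) - 2 * (u \<bullet> W) + (\<Sum>j\<in>UNIV. \<Lambda> j * \<bar>\<beta> $ j + u $ j\<bar>)
      \<le> v \<bullet> (D *v v) - 2 * (v \<bullet> W) + (\<Sum>j\<in>UNIV. \<Lambda> j * \<bar>\<beta> $ j + v $ j\<bar>)"
    and C: "pos_def_mat C" and c: "0 < c" "\<And>v. c * (norm v)\<^sup>2 \<le> v \<bullet> (C *v v)"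
    and D: "transpose D = D"
    and G: "\<And>v w. \<bar>v \<bullet> (C *v w)\<bar> \<le> G * norm v * norm w"
    and \<kappa>: "\<And>v w. \<bar>v \<bullet> ((D - C) *v w)\<bar> \<le> \<kappa> * norm v * norm w" "0 \<le> \<kappa>" "\<kappa> \<le> c / 2"
    and W: "norm W \<le> K"
    and in_A: "\<forall>j\<in>A. 0 \<le> \<Lambda> j \<and> \<Lambda> j \<le> \<delta>"
    and out_A: "\<forall>j. j \<notin> A \<longrightarrow> \<beta> $ j = 0 \<and> L \<le> \<Lambda> j"
    and \<delta>: "0 \<le> \<delta>" and R: "R = 2 * (2 * K + m * \<delta>) / c"
    and L: "2 * R * (G + \<kappa>) + 2 * K < L" and G0: "0 \<le> G"
  shows "norm u \<le> R" and "\<And>j. j \<notin> A \<Longrightarrow> u $ j = 0"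
    and "norm (u - sub_inv_embed A C *v W)
      \<le> (m * \<delta> + \<kappa> * (R + norm (sub_inv_embed A C *v W))) / c"
proof -
  have \<Lambda>A: "0 \<le> \<Lambda> j \<and> \<Lambda> j \<le> \<delta>" if "j \<in> A" for j using in_A that by blast
  have \<Lambda>N: "L \<le> \<Lambda> j" and \<beta>0: "\<beta> $ j = 0" if "j \<notin> A" for j using out_A that by auto
  have K: "0 \<le> K" using W norm_ge_zero order_trans by blast
  have R0: "0 \<le> R" using K \<delta> c(1) by (simp add: R m_def)
  have L0: "0 \<le> L"
  proof -
    have "0 \<le> 2 * R * (G + \<kappa>) + 2 * K" using R0 G0 \<kappa>(2) K by simp
    with L show ?thesis by linarith
  qed
  have dW: "\<bar>d \<bullet> W\<bar> \<le> norm d * K" for d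
    using Cauchy_Schwarz_ineq2[of d W] W by (meson mult_left_mono norm_ge_zero order_trans)
  have D_split: "v \<bullet> (D *v w) = v \<bullet> (C *v w) + v \<bullet> ((D - C) *v w)" for v w
    by (simp add: matrix_vector_mult_diff_rdistrib inner_diff_right)
  have D_diff: "u \<bullet> (D *v u) - v \<bullet> (D *v v) = (u - v) \<bullet> (D *v (u + v))" for v
    using symmetric_matrix_inner[OF D, of u v]
    by (simp add: matrix_vector_right_distrib inner_diff_left inner_add_right)
  have divide_norm: "norm d \<le> b / a" if "a * (norm d)\<^sup>2 \<le> b * norm d" "0 < a" "0 \<le> b"
    for a b :: real and d :: "real^'n"
    using that by (cases "d = 0") (auto simp: power2_eq_square le_divide_eq mult.commute)
  \<comment> \<open>Moving from \<open>u\<close> to a competitor that vanishes off \<open>A\<close>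
    cannot raise the inactive penalty, however large its weights, and changes each active term by at
    most \<open>\<delta>\<close> times the distance.\<close>
  have pen_abs: "\<Lambda> j * (\<bar>\<beta> $ j + v $ j\<bar> - \<bar>\<beta> $ j + u $ j\<bar>) \<le> \<delta> * norm (u - v)"
    if "j \<notin> A \<Longrightarrow> v $ j = 0" "j \<in> A \<or> 0 \<le> \<Lambda> j" for j v
  proof (cases "j \<in> A")
    case True
    have "\<Lambda> j * (\<bar>\<beta> $ j + v $ j\<bar> - \<bar>\<beta> $ j + u $ j\<bar>) \<le> \<Lambda> j * \<bar>(u - v) $ j\<bar>"
      using \<Lambda>A[OF True] by (intro mult_left_mono) auto
    also have "\<dots> \<le> \<delta> * norm (u - v)"
      using \<Lambda>A[OF True] by (intro mult_mono component_le_norm_cart) auto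
    finally show ?thesis .
  next
    case False
    then have "\<beta> $ j = 0" by (rule \<beta>0)
    then have "\<Lambda> j * (\<bar>\<beta> $ j + v $ j\<bar> - \<bar>\<beta> $ j + u $ j\<bar>) \<le> 0"
      using False that \<Lambda>N[OF False] L0 by (simp add: mult_nonneg_nonpos)
    also have "0 \<le> \<delta> * norm (u - v)" using \<delta> by simp
    finally show ?thesis .
  qed
  have pen: "(\<Sum>j\<in>UNIV. \<Lambda> j * \<bar>\<beta> $ j + v $ j\<bar>) - (\<Sum>j\<in>UNIV. \<Lambda> j * \<bar>\<beta> $ j + u $ j\<bar>) \<le> m * \<delta> * norm (u - v)"
    if "\<And>j. j \<notin> A \<Longrightarrow> v $ j = 0" for v
  proof -
    have "(\<Sum>j\<in>UNIV. \<Lambda> j * \<bar>\<beta> $ j + v $ j\<bar>) - (\<Sum>j\<in>UNIV. \<Lambda> j * \<bar>\<beta> $ j + u $ j\<bar>)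
      = (\<Sum>j\<in>UNIV. \<Lambda> j * (\<bar>\<beta> $ j + v $ j\<bar> - \<bar>\<beta> $ j + u $ j\<bar>))"
      by (simp add: right_diff_distrib sum_subtractf)
    also have "\<dots> \<le> (\<Sum>j\<in>(UNIV::'n set). \<delta> * norm (u - v))"
      using that \<Lambda>N L0 by (intro sum_mono pen_abs) (auto intro: order_trans)
    finally show ?thesis by (simp add: m_def mult.assoc)
  qed
  \<comment> \<open>Competitor 0. As \<kappa> \<le> c / 2, half of the coercivity survives the
    passage from \<open>C\<close> to \<open>D\<close>; dividing by the norm of \<open>u\<close>
    yields \<open>R\<close>.\<close>
  have "c / 2 * (norm u)\<^sup>2 \<le> (2 * K + m * \<delta>) * norm u"
  proof -
    have "u \<bullet> (D *v u) - 2 * (u \<bullet> W) \<le> m * \<delta> * norm u"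
      using min[of 0] pen[of 0] by simp
    moreover have "u \<bullet> (D *v u) \<ge> c * (norm u)\<^sup>2 - c / 2 * (norm u)\<^sup>2"
    proof -
      have "\<kappa> * norm u * norm u \<le> c / 2 * (norm u)\<^sup>2"
        using mult_right_mono[OF \<kappa>(3), of "(norm u)\<^sup>2"] by (simp add: power2_eq_square mult.assoc)
      then show ?thesis using D_split[of u u] c(2)[of u] \<kappa>(1)[of u u] by linarith
    qed
    ultimately show ?thesis using dW[of u] by (simp add: algebra_simps)
  qed
  from divide_norm[OF this] show uR: "norm u \<le> R"
    using c(1) K \<delta> by (simp add: R m_def mult.commute)
  show supp: "u $ j = 0" if "j \<notin> A" for j
  proof -
    \<comment> \<open>Dropping the inactive part \<open>d\<close> saves at least
      \<open>L * norm d\<close> of penalty, while the quadratic and linear parts change by at most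
      \<open>2 * R * (G + \<kappa>) + 2 * K\<close> times \<open>norm d\<close>. The choice of
      \<open>L\<close> leaves only d = 0.\<close>
    define v where "v = restrict_vec A u"
    define d where "d = u - v"
    have "norm v \<le> norm u" by (rule norm_le_componentwise_cart) (simp add: v_def restrict_vec_def)
    then have uv: "norm (u + v) \<le> 2 * R" using uR norm_triangle_ineq[of u v] by linarith
    have "\<bar>d \<bullet> (D *v (u + v))\<bar> \<le> G * norm d * norm (u + v) + \<kappa> * norm d * norm (u + v)"
      using D_split[of d "u + v"] G[of d "u + v"] \<kappa>(1)[of d "u + v"] by linarith
    also have "\<dots> = (G + \<kappa>) * norm d * norm (u + v)" by (simp add: algebra_simps)
    also have "\<dots> \<le> (G + \<kappa>) * norm d * (2 * R)" using uv G0 \<kappa>(2) by (intro mult_left_mono) auto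
    finally have 1: "u \<bullet> (D *v u) - v \<bullet> (D *v v) \<ge> - ((G + \<kappa>) * norm d * (2 * R))"
      unfolding D_diff d_def by linarith
    have 2: "u \<bullet> W - v \<bullet> W \<le> norm d * K" using dW[of d] by (simp add: d_def inner_diff_left)
    have "L * norm d \<le> L * (\<Sum>j\<in>UNIV. \<bar>d $ j\<bar>)" by (intro mult_left_mono norm_le_l1_cart L0)
    also have "\<dots> \<le> (\<Sum>j\<in>UNIV. \<Lambda> j * \<bar>\<beta> $ j + u $ j\<bar> - \<Lambda> j * \<bar>\<beta> $ j + v $ j\<bar>)"
      unfolding sum_distrib_left
    proof (rule sum_mono)
      fix j
      show "L * \<bar>d $ j\<bar> \<le> \<Lambda> j * \<bar>\<beta> $ j + u $ j\<bar> - \<Lambda> j * \<bar>\<beta> $ j + v $ j\<bar>"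
      proof (cases "j \<in> A")
        case True
        then show ?thesis by (simp add: d_def v_def restrict_vec_def)
      next
        case False
        then have "\<beta> $ j = 0" by (rule \<beta>0)
        then show ?thesis using False \<Lambda>N[OF False]
          by (simp add: d_def v_def restrict_vec_def mult_right_mono)
      qed
    qed
    also have "\<dots> = (\<Sum>j\<in>UNIV. \<Lambda> j * \<bar>\<beta> $ j + u $ j\<bar>) - (\<Sum>j\<in>UNIV. \<Lambda> j * \<bar>\<beta> $ j + v $ j\<bar>)"
      by (simp add: sum_subtractf)
    finally have "L * norm d \<le> (G + \<kappa>) * norm d * (2 * R) + 2 * (norm d * K)"
      using min[of v] 1 2 by linarith
    then have "(L - (2 * R * (G + \<kappa>) + 2 * K)) * norm d \<le> 0" by (simp add: algebra_simps)
    then have "norm d = 0" using L by (simp add: mult_le_0_iff)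
    then have "u = v" by (simp add: d_def)
    then have "u $ j = restrict_vec A u $ j" by (simp add: v_def)
    then show ?thesis using that by (simp add: restrict_vec_def)
  qed
  \<comment> \<open>Since \<open>s\<close> solves the normal equation on \<open>A\<close>, the
    linear terms cancel in the comparison with \<open>u\<close>. What remains is coercivity in
    \<open>d\<close> against the errors from \<open>\<delta>\<close> and
    \<open>\<kappa>\<close>.\<close>
  define s where "s = sub_inv_embed A C *v W"
  define d where "d = u - s"
  have s0: "s $ j = 0" if "j \<notin> A" for j using sub_inv_embed_supp[OF C that] by (simp add: s_def)
  have dCs: "d \<bullet> (C *v s) = d \<bullet> W"
    unfolding s_def by (rule inner_mult_sub_inv_embed[OF C]) (simp add: d_def supp s0)
  have "d \<bullet> (C *v (u + s)) = d \<bullet> (C *v d) + 2 * (d \<bullet> W)"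
  proof -
    have "u + s = d + (s + s)" by (simp add: d_def)
    then show ?thesis by (simp only: matrix_vector_right_distrib inner_add_right dCs mult_2)
  qed
  moreover have "\<bar>d \<bullet> ((D - C) *v (u + s))\<bar> \<le> \<kappa> * norm d * (R + norm s)"
  proof -
    have "norm (u + s) \<le> R + norm s" using norm_triangle_ineq[of u s] uR by linarith
    then show ?thesis using \<kappa>(1)[of d "u + s"] \<kappa>(2)
      by (meson mult_left_mono mult_nonneg_nonneg norm_ge_zero order_trans)
  qed
  ultimately have "c * (norm d)\<^sup>2 + 2 * (d \<bullet> W) - \<kappa> * norm d * (R + norm s) \<le> u \<bullet> (D *v u) - s \<bullet> (D *v s)"
    using D_diff[of s] D_split[of d "u + s"] c(2)[of d] by (simp add: d_def)
  moreover have "u \<bullet> W - s \<bullet> W = d \<bullet> W" by (simp add: d_def inner_diff_left)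
  ultimately have "c * (norm d)\<^sup>2 \<le> m * \<delta> * norm d + \<kappa> * norm d * (R + norm s)"
    using min[of s] pen[OF s0] unfolding d_def by linarith
  then have "c * (norm d)\<^sup>2 \<le> (m * \<delta> + \<kappa> * (R + norm s)) * norm d" by (simp add: algebra_simps)
  from divide_norm[OF this c(1)] show "norm (u - sub_inv_embed A C *v W)
      \<le> (m * \<delta> + \<kappa> * (R + norm (sub_inv_embed A C *v W))) / c"
    using \<delta> \<kappa>(2) R0 by (simp add: d_def s_def m_def)
qed

section \<open>Adaptive weights and the Gram matrix\<close>

text \<open>Within K / sqrt n of \<open>b\<close>, eventually |z| \<ge> |b| / 2, and \<alpha> n
  \<ge> (c1 / 2) sqrt n, so the radicand is at least q sqrt n. Uniformity in \<open>z\<close> is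
  required because a random estimate is inserted later.\<close>

lemma adaptive_weight_active:
  fixes \<eta> \<alpha> :: "nat \<Rightarrow> real"
  assumes eta1: "(\<lambda>n. \<eta> n / real n powr (3/4)) \<longlonglongrightarrow> 0"
    and eta2: "filterlim (\<lambda>n. \<eta> n / sqrt (real n)) at_top sequentially"
    and alpha: "(\<lambda>n. \<alpha> n / sqrt (real n)) \<longlonglongrightarrow> c1" and c1: "0 < c1"
    and b: "b \<noteq> 0" and d: "0 < \<delta>"
  shows "\<forall>\<^sub>F n in sequentially. \<forall>z. sqrt (real n) * \<bar>z - b\<bar> \<le> K \<longrightarrow>
    0 \<le> \<eta> n / sqrt (1 + 2 * \<alpha> n * \<bar>z\<bar>) / sqrt (real n) \<and>
    \<eta> n / sqrt (1 + 2 * \<alpha> n * \<bar>z\<bar>) / sqrt (real n) \<le> \<delta>"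
proof -
  define q where "q = c1 * \<bar>b\<bar> / 2"
  have q: "0 < q" using c1 b by (simp add: q_def)
  have "\<forall>\<^sub>F n in sequentially. \<eta> n / real n powr (3/4) < \<delta> * sqrt q"
    using order_tendstoD(2)[OF eta1] d q by simp
  moreover have "\<forall>\<^sub>F n in sequentially. 1 \<le> \<eta> n / sqrt (real n)"
    using eta2 by (simp add: filterlim_at_top)
  moreover have "\<forall>\<^sub>F n in sequentially. c1 / 2 < \<alpha> n / sqrt (real n)"
    using order_tendstoD(1)[OF alpha, of "c1 / 2"] c1 by simp
  moreover have "\<forall>\<^sub>F n in sequentially. 2 * K / \<bar>b\<bar> \<le> sqrt (real n)"
    using filterlim_compose[OF sqrt_at_top filterlim_real_sequentially] by (simp add: filterlim_at_top)
  ultimately show ?thesis using eventually_gt_at_top[of 0]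
  proof eventually_elim
    case (elim n)
    define s where "s = sqrt (real n)"
    have s: "0 < s" using elim by (simp add: s_def)
    have \<eta>: "0 < \<eta> n"
    proof -
      have "s \<le> \<eta> n" using elim(2) s by (simp add: s_def[symmetric] le_divide_eq)
      with s show ?thesis by linarith
    qed
    have \<alpha>: "c1 / 2 * s < \<alpha> n" using elim(3) s by (simp add: s_def[symmetric] less_divide_eq)
    show ?case
    proof (intro allI impI)
      fix z assume "sqrt (real n) * \<bar>z - b\<bar> \<le> K"
      also have "K \<le> s * (\<bar>b\<bar> / 2)" using elim(4) b by (simp add: s_def[symmetric] divide_le_eq)
      finally have "\<bar>z - b\<bar> \<le> \<bar>b\<bar> / 2" using s by (simp add: s_def[symmetric])
      then have z: "\<bar>b\<bar> / 2 \<le> \<bar>z\<bar>" by linarith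
      have "0 \<le> c1 / 2 * s" using c1 s by simp
      with \<alpha> have "c1 / 2 * s * (\<bar>b\<bar> / 2) \<le> \<alpha> n * \<bar>z\<bar>"
        using z by (intro mult_mono) auto
      moreover have "q * s = 2 * (c1 / 2 * s * (\<bar>b\<bar> / 2))" by (simp add: q_def)
      ultimately have ge: "q * s \<le> 1 + 2 * \<alpha> n * \<bar>z\<bar>" by linarith
      have qs: "0 < q * s" using q s by simp
      have "\<eta> n / sqrt (1 + 2 * \<alpha> n * \<bar>z\<bar>) / s \<le> \<eta> n / sqrt (q * s) / s"
        using ge qs \<eta> s by (intro divide_right_mono divide_left_mono) auto
      \<comment> \<open>The exponent 3/4 arises here, as 1/4 from the root in the weight plus 1/2
        from the rescaling.\<close>
      also have "sqrt (q * s) * s = sqrt q * real n powr (3/4)"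
      proof -
        have "sqrt s * s = real n powr (1/4) * real n powr (1/2)"
          using elim(5) by (simp add: s_def powr_half_sqrt[symmetric] powr_powr)
        then show ?thesis using elim(5) by (simp add: real_sqrt_mult mult.assoc flip: powr_add)
      qed
      then have "\<eta> n / sqrt (q * s) / s = (\<eta> n / real n powr (3/4)) / sqrt q"
        by (simp add: mult.commute)
      also have "\<dots> \<le> \<delta>" using elim(1) q by (subst pos_divide_le_eq) auto
      finally have "\<eta> n / sqrt (1 + 2 * \<alpha> n * \<bar>z\<bar>) / s \<le> \<delta>" .
      moreover have "0 \<le> \<eta> n / sqrt (1 + 2 * \<alpha> n * \<bar>z\<bar>) / s" using ge qs \<eta> s by simp
      ultimately show "0 \<le> \<eta> n / sqrt (1 + 2 * \<alpha> n * \<bar>z\<bar>) / sqrt (real n) \<and>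
        \<eta> n / sqrt (1 + 2 * \<alpha> n * \<bar>z\<bar>) / sqrt (real n) \<le> \<delta>" by (simp add: s_def)
    qed
  qed
qed

text \<open>With sqrt n |z| bounded and \<alpha> n \<le> 2 c1 sqrt n, the radicand stays below the
  constant \<open>q\<close>, and the weight inherits the divergence of \<eta> n / sqrt n.\<close>

lemma adaptive_weight_inactive:
  fixes \<eta> \<alpha> :: "nat \<Rightarrow> real"
  assumes eta2: "filterlim (\<lambda>n. \<eta> n / sqrt (real n)) at_top sequentially"
    and alpha: "(\<lambda>n. \<alpha> n / sqrt (real n)) \<longlonglongrightarrow> c1" and c1: "0 < c1"
    and K: "0 \<le> K" and L: "0 \<le> L"
  shows "\<forall>\<^sub>F n in sequentially. \<forall>z. sqrt (real n) * \<bar>z\<bar> \<le> K \<longrightarrow>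
    L \<le> \<eta> n / sqrt (1 + 2 * \<alpha> n * \<bar>z\<bar>) / sqrt (real n)"
proof -
  define q where "q = 1 + 4 * c1 * K"
  have q: "1 \<le> q" using c1 K by (simp add: q_def)
  have "\<forall>\<^sub>F n in sequentially. L * sqrt q \<le> \<eta> n / sqrt (real n)"
    using eta2 by (simp add: filterlim_at_top)
  moreover have "\<forall>\<^sub>F n in sequentially. \<alpha> n / sqrt (real n) < 2 * c1"
    using order_tendstoD(2)[OF alpha, of "2 * c1"] c1 by simp
  moreover have "\<forall>\<^sub>F n in sequentially. 0 < \<alpha> n / sqrt (real n)"
    using order_tendstoD(1)[OF alpha c1] .
  ultimately show ?thesis using eventually_gt_at_top[of 0]
  proof eventually_elim
    case (elim n)
    define s where "s = sqrt (real n)"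
    have s: "0 < s" using elim by (simp add: s_def)
    have \<alpha>: "\<alpha> n \<le> 2 * c1 * s" "0 < \<alpha> n"
      using elim(2,3) s by (simp_all add: s_def[symmetric] divide_less_eq zero_less_divide_iff)
    show ?case
    proof (intro allI impI)
      fix z assume z: "sqrt (real n) * \<bar>z\<bar> \<le> K"
      have "\<alpha> n * \<bar>z\<bar> \<le> 2 * c1 * s * \<bar>z\<bar>" using \<alpha>(1) by (rule mult_right_mono) simp
      also have "\<dots> \<le> 2 * c1 * K" using z c1 by (simp add: s_def mult.assoc)
      finally have le: "1 + 2 * \<alpha> n * \<bar>z\<bar> \<le> q" unfolding q_def by linarith
      have pos: "0 < 1 + 2 * \<alpha> n * \<bar>z\<bar>" using \<alpha>(2) by (simp add: add_pos_nonneg)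
      have "0 \<le> L * sqrt q" using L q by simp
      then have "0 \<le> \<eta> n / s" using elim(1) unfolding s_def by linarith
      then have "(\<eta> n / s) / sqrt q \<le> (\<eta> n / s) / sqrt (1 + 2 * \<alpha> n * \<bar>z\<bar>)"
        using le pos by (intro divide_left_mono) auto
      moreover have "L \<le> (\<eta> n / s) / sqrt q"
        using elim(1) q by (subst pos_le_divide_eq) (auto simp: s_def)
      ultimately show "L \<le> \<eta> n / sqrt (1 + 2 * \<alpha> n * \<bar>z\<bar>) / sqrt (real n)"
        by (simp add: s_def mult.commute)
    qed
  qed
qed

section \<open>The Gram matrix of the design and the rescaled objective\<close>

definition gram :: "(nat \<Rightarrow> real^'n) \<Rightarrow> nat \<Rightarrow> real^'n^'n" where
  "gram x n = (1 / real n) *\<^sub>R (\<Sum>i=1..n. (\<chi> k l. x i $ k * x i $ l))"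

lemma gram_nth: "gram x n $ k $ l = (\<Sum>i=1..n. x i $ k * x i $ l) / real n"
  by (simp add: gram_def)

lemma transpose_gram: "transpose (gram x n) = gram x n"
  by (simp add: transpose_def vec_eq_iff gram_nth mult.commute)

lemma gram_form: "v \<bullet> (gram x n *v w) = (\<Sum>i=1..n. (x i \<bullet> v) * (x i \<bullet> w)) / real n"
proof -
  have "v \<bullet> (gram x n *v w) = (\<Sum>k\<in>UNIV. \<Sum>l\<in>UNIV. \<Sum>i=1..n. v $ k * x i $ k * (x i $ l * w $ l)) / real n"
    unfolding matrix_vector_mult_sum_components gram_nth sum_divide_distrib
    by (simp add: sum_distrib_left sum_distrib_right mult_ac)
  also have "(\<Sum>k\<in>UNIV. \<Sum>l\<in>UNIV. \<Sum>i=1..n. v $ k * x i $ k * (x i $ l * w $ l))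
    = (\<Sum>i=1..n. \<Sum>k\<in>UNIV. \<Sum>l\<in>UNIV. v $ k * x i $ k * (x i $ l * w $ l))"
  proof -
    have "(\<Sum>k\<in>UNIV. \<Sum>l\<in>UNIV. \<Sum>i=1..n. v $ k * x i $ k * (x i $ l * w $ l))
      = (\<Sum>k\<in>UNIV. \<Sum>i=1..n. \<Sum>l\<in>UNIV. v $ k * x i $ k * (x i $ l * w $ l))"
      by (intro sum.cong refl sum.swap)
    also have "\<dots> = (\<Sum>i=1..n. \<Sum>k\<in>UNIV. \<Sum>l\<in>UNIV. v $ k * x i $ k * (x i $ l * w $ l))"
      by (rule sum.swap)
    finally show ?thesis .
  qed
  also have "\<dots> = (\<Sum>i=1..n. (x i \<bullet> v) * (x i \<bullet> w))"
    by (simp add: inner_vec_def sum_product mult_ac)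
  finally show ?thesis .
qed

text \<open>Through the trace, convergence of the Gram matrices gives convergence of the mean
  squared row norm. Negligibility of the score weights and the second moment of the score both
  depend on it.\<close>

lemma gram_trace: "(\<Sum>i=1..n. (norm (x i))\<^sup>2) / real n = (\<Sum>k\<in>UNIV. gram x n $ k $ k)"
proof -
  have "(\<Sum>i=1..n. (norm (x i))\<^sup>2) = (\<Sum>k\<in>UNIV. \<Sum>i=1..n. x i $ k * x i $ k)"
    unfolding power2_norm_eq_inner inner_vec_def inner_real_def by (rule sum.swap)
  then show ?thesis by (simp add: gram_nth sum_divide_distrib)
qed

lemma gram_trace_tendsto:
  assumes "gram x \<longlonglongrightarrow> C"
  shows "(\<lambda>n. (\<Sum>i=1..n. (norm (x i))\<^sup>2) / real n) \<longlonglongrightarrow> (\<Sum>k\<in>UNIV. C $ k $ k)"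
  unfolding gram_trace by (intro tendsto_intros assms)

lemma matrix_form_tendsto:
  fixes D :: "nat \<Rightarrow> real^'n^'n"
  assumes "D \<longlonglongrightarrow> C" shows "(\<lambda>n. v \<bullet> (D n *v w)) \<longlonglongrightarrow> v \<bullet> (C *v w)"
  unfolding matrix_vector_mult_sum_components by (intro tendsto_intros assms)

definition lasso_objective :: "(nat \<Rightarrow> real^'n) \<Rightarrow> (nat \<Rightarrow> real) \<Rightarrow> ('n \<Rightarrow> real) \<Rightarrow> nat \<Rightarrow> real^'n \<Rightarrow> real" where
  "lasso_objective x y w n b = (\<Sum>i=1..n. (y i - x i \<bullet> b)\<^sup>2) + (\<Sum>j\<in>UNIV. w j * \<bar>b $ j\<bar>)"

text \<open>The noise energy does not involve \<open>v\<close> and cancels in comparisons. The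
  weights reappear divided by sqrt n, which is the scale on which they vanish or diverge.\<close>

lemma lasso_objective_rescaled:
  fixes x :: "nat \<Rightarrow> real^'n" and b v :: "real^'n"
  assumes n: "0 < n"
  defines "s \<equiv> sqrt (real n)"
  shows "lasso_objective x (\<lambda>i. x i \<bullet> b + e i) w n (b + (1 / s) *\<^sub>R v)
    = (\<Sum>i=1..n. (e i)\<^sup>2) + (v \<bullet> (gram x n *v v) - 2 * (v \<bullet> ((1 / s) *\<^sub>R (\<Sum>i=1..n. e i *\<^sub>R x i)))
      + (\<Sum>j\<in>UNIV. w j / s * \<bar>(s *\<^sub>R b) $ j + v $ j\<bar>))"
proof -
  have s: "0 < s" "s * s = real n" using n by (simp_all add: s_def)
  have "(x i \<bullet> b + e i - x i \<bullet> (b + (1 / s) *\<^sub>R v))\<^sup>2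
    = (e i)\<^sup>2 + ((x i \<bullet> v) * (x i \<bullet> v) / real n - 2 * (1 / s * (e i * (x i \<bullet> v))))" for i
    using s(1) by (simp add: inner_add_right power2_eq_square algebra_simps flip: s(2))
  then have 1: "(\<Sum>i=1..n. (x i \<bullet> b + e i - x i \<bullet> (b + (1 / s) *\<^sub>R v))\<^sup>2)
    = (\<Sum>i=1..n. (e i)\<^sup>2) + (v \<bullet> (gram x n *v v) - 2 * (v \<bullet> ((1 / s) *\<^sub>R (\<Sum>i=1..n. e i *\<^sub>R x i))))"
    by (simp add: gram_form sum.distrib sum_subtractf sum_distrib_left sum_divide_distrib inner_sum_right inner_commute[of v])
  have "\<bar>(b + (1 / s) *\<^sub>R v) $ j\<bar> = \<bar>(s *\<^sub>R b) $ j + v $ j\<bar> / s" for j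
  proof -
    have "(b + (1 / s) *\<^sub>R v) $ j = ((s *\<^sub>R b) $ j + v $ j) / s" using s(1) by (simp add: field_simps)
    then show ?thesis using s(1) by simp
  qed
  then have "(\<Sum>j\<in>UNIV. w j * \<bar>(b + (1 / s) *\<^sub>R v) $ j\<bar>) = (\<Sum>j\<in>UNIV. w j / s * \<bar>(s *\<^sub>R b) $ j + v $ j\<bar>)"
    by simp
  with 1 show ?thesis by (simp add: lasso_objective_def)
qed

section \<open>Asymptotics of the score vector and of the minimizer\<close>

text \<open>The projection on \<open>t\<close> is a weighted noise sum whose squared weights add up
  to the Gram form at \<open>t\<close>; the weights are negligible because the mean squared row norm
  converges.\<close>

lemma (in prob_space) cf_score_tendsto:
  fixes X :: "nat \<Rightarrow> 'a \<Rightarrow> real" and x :: "nat \<Rightarrow> real^'n"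
  assumes design: "gram x \<longlonglongrightarrow> C"
    and indep: "indep_vars (\<lambda>_. borel) X {1..}"
    and distr: "\<And>i. i \<ge> 1 \<Longrightarrow> distr M borel (X i) = distr M borel (X 1)"
    and int: "\<And>i. i \<ge> 1 \<Longrightarrow> integrable M (X i)" "\<And>i. i \<ge> 1 \<Longrightarrow> integrable M (\<lambda>\<omega>. (X i \<omega>)\<^sup>2)"
    and mean: "\<And>i. i \<ge> 1 \<Longrightarrow> expectation (X i) = 0"
    and var: "\<And>i. i \<ge> 1 \<Longrightarrow> expectation (\<lambda>\<omega>. (X i \<omega>)\<^sup>2) = \<sigma>\<^sup>2"
  shows "(\<lambda>n. LINT \<omega>|M. cis (t \<bullet> ((1 / sqrt (real n)) *\<^sub>R (\<Sum>i=1..n. X i \<omega> *\<^sub>R x i))))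
    \<longlonglongrightarrow> complex_of_real (exp (- (\<sigma>\<^sup>2 * (t \<bullet> (C *v t))) / 2))"
proof -
  note trace = gram_trace_tendsto[OF design]
  have inner: "t \<bullet> ((1 / sqrt (real n)) *\<^sub>R (\<Sum>i=1..n. X i \<omega> *\<^sub>R x i))
      = (\<Sum>i=1..n. (t \<bullet> x i / sqrt (real n)) * X i \<omega>)" for n \<omega>
    by (simp add: inner_sum_right sum_distrib_left mult_ac)
  show ?thesis
    unfolding inner
  proof (rule cf_weighted_sum_tendsto)
    show "(\<lambda>n. \<Sum>i=1..n. (t \<bullet> x i / sqrt (real n))\<^sup>2) \<longlonglongrightarrow> t \<bullet> (C *v t)"
    proof -
      have "(\<Sum>i=1..n. (t \<bullet> x i / sqrt (real n))\<^sup>2) = t \<bullet> (gram x n *v t)" for n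
        by (simp add: gram_form power_divide sum_divide_distrib inner_commute power2_eq_square[of "_ \<bullet> _"])
      then show ?thesis using matrix_form_tendsto[OF design] by simp
    qed
    fix d :: real assume d: "0 < d"
    \<comment> \<open>\<open>norm t + 1\<close> in place of \<open>norm t\<close> covers t =
      0.\<close>
    define r where "r = (d / (norm t + 1))\<^sup>2"
    have t1: "0 < norm t + 1" by (simp add: add_nonneg_pos)
    then have "0 < r" using d by (simp add: r_def)
    from eventually_all_le_of_convergent_mean[OF trace _ this]
    have "\<forall>\<^sub>F n in sequentially. \<forall>i\<in>{1..n}. (norm (x i))\<^sup>2 \<le> r * real n" by simp
    then show "\<forall>\<^sub>F n in sequentially. \<forall>i\<in>{1..n}. \<bar>t \<bullet> x i / sqrt (real n)\<bar> \<le> d"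
    proof eventually_elim
      case (elim n)
      show ?case
      proof
        fix i assume i: "i \<in> {1..n}"
        have "norm (x i) \<le> sqrt (r * real n)" using elim i real_le_rsqrt by auto
        also have "\<dots> = d / (norm t + 1) * sqrt (real n)" using d t1 by (simp add: r_def real_sqrt_mult)
        finally have "\<bar>t \<bullet> x i\<bar> \<le> (norm t + 1) * (d / (norm t + 1) * sqrt (real n))"
          using Cauchy_Schwarz_ineq2[of t "x i"] t1
          by (meson add_increasing2 mult_mono norm_ge_zero order_refl order_trans zero_le_one less_imp_le)
        also have "\<dots> = d * sqrt (real n)" using t1 by simp
        finally show "\<bar>t \<bullet> x i / sqrt (real n)\<bar> \<le> d" using i by (simp add: divide_le_eq)
      qed
    qed
  next
    show "distr M borel (X i) = distr M borel (X 1)" if "1 \<le> i" for i by (rule distr[OF that])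
  qed (rule indep int(1)[OF order_refl] mean[OF order_refl] int(2)[OF order_refl] var[OF order_refl])+
qed

text \<open>Markov's inequality for the squared norm, whose mean is \<sigma>^2 times the trace of
  the Gram matrix.\<close>

lemma (in prob_space) score_tight:
  fixes X :: "nat \<Rightarrow> 'a \<Rightarrow> real" and x :: "nat \<Rightarrow> real^'n"
  defines "W \<equiv> (\<lambda>n \<omega>. (1 / sqrt (real n)) *\<^sub>R (\<Sum>i=1..n. X i \<omega> *\<^sub>R x i))"
  assumes design: "gram x \<longlonglongrightarrow> C"
    and indep: "indep_vars (\<lambda>_. borel) X {1..}"
    and int: "\<And>i. i \<ge> 1 \<Longrightarrow> integrable M (X i)" "\<And>i. i \<ge> 1 \<Longrightarrow> integrable M (\<lambda>\<omega>. (X i \<omega>)\<^sup>2)"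
    and mean: "\<And>i. i \<ge> 1 \<Longrightarrow> expectation (X i) = 0"
    and var: "\<And>i. i \<ge> 1 \<Longrightarrow> expectation (\<lambda>\<omega>. (X i \<omega>)\<^sup>2) = \<sigma>\<^sup>2"
    and e: "0 < e"
  shows "\<exists>K. \<forall>\<^sub>F n in sequentially. prob {\<omega>\<in>space M. norm (W n \<omega>) > K} < e"
proof -
  have rv: "X i \<in> borel_measurable M" if "i \<ge> 1" for i using int(1)[OF that] by simp
  have [measurable]: "W n \<in> borel_measurable M" for n
    unfolding W_def using rv by (intro borel_measurable_scaleR borel_measurable_sum) auto
  define B where "B = \<sigma>\<^sup>2 * ((\<Sum>k\<in>UNIV. C $ k $ k) + 1)"
  \<comment> \<open>With |B| + 1 in the numerator the radius is positive and B / K^2 < e holds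
    strictly, also when \<open>B\<close> is 0.\<close>
  define K where "K = sqrt ((\<bar>B\<bar> + 1) / e)"
  have K: "0 < K" "K\<^sup>2 = (\<bar>B\<bar> + 1) / e" using e by (simp_all add: K_def add_nonneg_pos)
  have "\<forall>\<^sub>F n in sequentially. (\<Sum>i=1..n. (norm (x i))\<^sup>2) / real n < (\<Sum>k\<in>UNIV. C $ k $ k) + 1"
    by (rule order_tendstoD(2)[OF gram_trace_tendsto[OF design]]) simp
  then have "\<forall>\<^sub>F n in sequentially. prob {\<omega>\<in>space M. norm (W n \<omega>) > K} < e"
  proof eventually_elim
    case (elim n)
    let ?X = "\<lambda>\<omega>. \<Sum>i=1..n. X i \<omega> *\<^sub>R x i"
    have ind: "indep_vars (\<lambda>_. borel) X {1..n}" by (rule indep_vars_subset[OF indep]) auto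
    have W2: "(norm (W n \<omega>))\<^sup>2 = (norm (?X \<omega>))\<^sup>2 / real n" for \<omega>
      by (simp add: W_def power_mult_distrib power_divide)
    have int_W: "integrable M (\<lambda>\<omega>. (norm (W n \<omega>))\<^sup>2)"
      unfolding W2 by (intro integrable_divide expectation_norm_weighted_sum(1)[OF ind, where \<sigma>=\<sigma>])
        (use int mean var in auto)
    have "expectation (\<lambda>\<omega>. (norm (?X \<omega>))\<^sup>2) = \<sigma>\<^sup>2 * (\<Sum>i=1..n. (norm (x i))\<^sup>2)"
      by (rule expectation_norm_weighted_sum(2)[OF ind]) (use int mean var in auto)
    then have "expectation (\<lambda>\<omega>. (norm (W n \<omega>))\<^sup>2) = \<sigma>\<^sup>2 * ((\<Sum>i=1..n. (norm (x i))\<^sup>2) / real n)"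
      unfolding W2 by simp
    also have "\<dots> \<le> B" unfolding B_def using elim by (intro mult_left_mono) auto
    finally have B: "expectation (\<lambda>\<omega>. (norm (W n \<omega>))\<^sup>2) \<le> B" .
    have "prob {\<omega>\<in>space M. norm (W n \<omega>) > K} \<le> prob {\<omega>\<in>space M. (norm (W n \<omega>))\<^sup>2 \<ge> K\<^sup>2}"
      using K(1) by (intro finite_measure_mono) (auto intro!: power_mono)
    also have "\<dots> \<le> expectation (\<lambda>\<omega>. (norm (W n \<omega>))\<^sup>2) / K\<^sup>2"
      by (rule integral_Markov_inequality_measure[OF int_W, of "{}"]) (use K(1) in auto)
    also have "\<dots> \<le> B / K\<^sup>2" using B by (rule divide_right_mono) simp
    also have "\<dots> < e"
    proof -
      have "0 < \<bar>B\<bar> + 1" "B < \<bar>B\<bar> + 1" by linarith+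
      then show ?thesis using e unfolding K(2) by (simp add: divide_less_eq)
    qed
    finally show ?case .
  qed
  then show ?thesis by blast
qed

text \<open>The pathwise core: noise and estimates are arbitrary vectors here, so the threshold for
  n does not depend on the outcome and serves a whole event at once.\<close>

lemma adaptive_lasso_eventually:
  fixes x :: "nat \<Rightarrow> real^'n" and bstar :: "real^'n" and C :: "real^'n^'n" and \<eta> \<alpha> :: "nat \<Rightarrow> real"
  defines "A \<equiv> {j. bstar $ j \<noteq> 0}"
    and "W \<equiv> (\<lambda>n e. (1 / sqrt (real n)) *\<^sub>R (\<Sum>i=1..n. e i *\<^sub>R x i))"
    and "u \<equiv> (\<lambda>n b. sqrt (real n) *\<^sub>R (b - bstar))"
  defines "S0 \<equiv> sub_inv_embed A C"
  assumes design: "gram x \<longlonglongrightarrow> C" and C_pd: "pos_def_mat C"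
    and eta1: "(\<lambda>n. \<eta> n / real n powr (3/4)) \<longlonglongrightarrow> 0"
    and eta2: "filterlim (\<lambda>n. \<eta> n / sqrt (real n)) at_top sequentially"
    and alpha: "(\<lambda>n. \<alpha> n / sqrt (real n)) \<longlonglongrightarrow> c1" and c1: "0 < c1"
    and K: "0 \<le> K" and \<rho>: "0 < \<rho>"
  shows "\<exists>R. \<forall>\<^sub>F n in sequentially. \<forall>e \<beta>0 \<beta>1. norm (W n e) \<le> K \<and> norm (u n \<beta>0) \<le> K \<and>
    (\<forall>b. lasso_objective x (\<lambda>i. x i \<bullet> bstar + e i) (\<lambda>j. \<eta> n / sqrt (1 + 2 * \<alpha> n * \<bar>\<beta>0 $ j\<bar>)) n \<beta>1
      \<le> lasso_objective x (\<lambda>i. x i \<bullet> bstar + e i) (\<lambda>j. \<eta> n / sqrt (1 + 2 * \<alpha> n * \<bar>\<beta>0 $ j\<bar>)) n b) \<longrightarrow>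
    {j. \<beta>1 $ j \<noteq> 0} = A \<and> norm (u n \<beta>1) \<le> R \<and> norm (restrict_vec A (u n \<beta>1) - S0 *v W n e) \<le> \<rho>"
proof -
  define m where "m = real CARD('n)"
  have m: "1 \<le> m" by (simp add: m_def Suc_leI)
  obtain c where c: "0 < c" "\<And>v. c * (norm v)\<^sup>2 \<le> v \<bullet> (C *v v)" using pos_def_mat_coercive[OF C_pd] by blast
  define G where "G = m * norm C"
  \<comment> \<open>The error (m \<delta> + \<kappa> (R + h)) / c is split evenly,
    \<open>\<delta>\<close> and \<open>\<kappa>\<close> contributing at most \<rho> / 2 each;
    \<open>h\<close> bounds the norm of \<open>S0 *v W n e\<close>. The 1 in \<open>\<kappa>\<close>
    keeps its denominator positive, the 1 in \<open>L\<close> makes the required inequality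
    strict.\<close>
  define \<delta> where "\<delta> = \<rho> * c / (2 * m)"
  define R where "R = 2 * (2 * K + m * \<delta>) / c"
  define h where "h = m * norm S0 * K"
  define \<kappa> where "\<kappa> = min (c / 2) (\<rho> * c / (2 * (R + h + 1)))"
  define L where "L = 2 * R * (G + \<kappa>) + 2 * K + 1"
  have \<delta>: "0 < \<delta>" using \<rho> c m by (simp add: \<delta>_def)
  have R: "0 \<le> R" using K \<delta> c m by (simp add: R_def)
  have h: "0 \<le> h" using K m by (simp add: h_def)
  have \<kappa>: "0 < \<kappa>" using \<rho> c R h by (simp add: \<kappa>_def)
  have \<kappa>c: "\<kappa> \<le> c / 2" unfolding \<kappa>_def by (rule min.cobounded1)
  have \<kappa>\<rho>: "\<kappa> \<le> \<rho> * c / (2 * (R + h + 1))" unfolding \<kappa>_def by (rule min.cobounded2)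
  have G: "0 \<le> G" using m by (simp add: G_def)
  have L: "0 \<le> L" using R G \<kappa> K by (simp add: L_def)
  have \<kappa>h: "\<kappa> * (R + h) \<le> \<rho> * c / 2"
  proof -
    have "\<kappa> * (R + h) \<le> \<rho> * c / (2 * (R + h + 1)) * (R + h + 1)"
      using R h \<kappa> \<kappa>\<rho> by (intro mult_mono) auto
    also have "\<dots> = \<rho> * c / 2" using R h by (simp add: field_simps)
    finally show ?thesis .
  qed
  have "(\<lambda>n. m * norm (gram x n - C)) \<longlonglongrightarrow> m * norm (C - C)" by (intro tendsto_intros design)
  then have "(\<lambda>n. m * norm (gram x n - C)) \<longlonglongrightarrow> 0" by simp
  from order_tendstoD(2)[OF this \<kappa>]
  have ev1: "\<forall>\<^sub>F n in sequentially. m * norm (gram x n - C) < \<kappa>" .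
  have ev2: "\<forall>\<^sub>F n in sequentially. \<forall>j\<in>A. \<forall>z. sqrt (real n) * \<bar>z - bstar $ j\<bar> \<le> K \<longrightarrow>
      0 \<le> \<eta> n / sqrt (1 + 2 * \<alpha> n * \<bar>z\<bar>) / sqrt (real n) \<and>
      \<eta> n / sqrt (1 + 2 * \<alpha> n * \<bar>z\<bar>) / sqrt (real n) \<le> \<delta>"
    by (intro eventually_ball_finite ballI adaptive_weight_active[OF eta1 eta2 alpha c1 _ \<delta>]) (auto simp: A_def)
  have ev3: "\<forall>\<^sub>F n in sequentially. \<forall>z. sqrt (real n) * \<bar>z\<bar> \<le> K \<longrightarrow>
      L \<le> \<eta> n / sqrt (1 + 2 * \<alpha> n * \<bar>z\<bar>) / sqrt (real n)"
    by (rule adaptive_weight_inactive[OF eta2 alpha c1 K L])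
  \<comment> \<open>Once sqrt n times |\<open>bstar $ j\<close>| exceeds \<open>R\<close>, the
    rescaled error can no longer cancel an active coefficient, so none is estimated as zero.\<close>
  have ev4: "\<forall>\<^sub>F n in sequentially. \<forall>j\<in>A. R / \<bar>bstar $ j\<bar> < sqrt (real n)"
    using filterlim_compose[OF sqrt_at_top filterlim_real_sequentially]
    by (intro eventually_ball_finite ballI) (auto simp: filterlim_at_top_dense)
  have "\<forall>\<^sub>F n in sequentially. \<forall>e \<beta>0 \<beta>1. norm (W n e) \<le> K \<and> norm (u n \<beta>0) \<le> K \<and>
    (\<forall>b. lasso_objective x (\<lambda>i. x i \<bullet> bstar + e i) (\<lambda>j. \<eta> n / sqrt (1 + 2 * \<alpha> n * \<bar>\<beta>0 $ j\<bar>)) n \<beta>1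
      \<le> lasso_objective x (\<lambda>i. x i \<bullet> bstar + e i) (\<lambda>j. \<eta> n / sqrt (1 + 2 * \<alpha> n * \<bar>\<beta>0 $ j\<bar>)) n b) \<longrightarrow>
    {j. \<beta>1 $ j \<noteq> 0} = A \<and> norm (u n \<beta>1) \<le> R \<and> norm (restrict_vec A (u n \<beta>1) - S0 *v W n e) \<le> \<rho>"
    using ev1 ev2 ev3 ev4 eventually_gt_at_top[of 0]
  proof eventually_elim
    case (elim n)
    define s where "s = sqrt (real n)"
    have s: "0 < s" using elim(5) by (simp add: s_def)
    show ?case
    proof (intro allI impI, elim conjE)
      fix e \<beta>0 \<beta>1
      assume WK: "norm (W n e) \<le> K" and b0: "norm (u n \<beta>0) \<le> K"
        and "\<forall>b. lasso_objective x (\<lambda>i. x i \<bullet> bstar + e i) (\<lambda>j. \<eta> n / sqrt (1 + 2 * \<alpha> n * \<bar>\<beta>0 $ j\<bar>)) n \<beta>1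
      \<le> lasso_objective x (\<lambda>i. x i \<bullet> bstar + e i) (\<lambda>j. \<eta> n / sqrt (1 + 2 * \<alpha> n * \<bar>\<beta>0 $ j\<bar>)) n b"
      then have b1_min: "lasso_objective x (\<lambda>i. x i \<bullet> bstar + e i) (\<lambda>j. \<eta> n / sqrt (1 + 2 * \<alpha> n * \<bar>\<beta>0 $ j\<bar>)) n \<beta>1
        \<le> lasso_objective x (\<lambda>i. x i \<bullet> bstar + e i) (\<lambda>j. \<eta> n / sqrt (1 + 2 * \<alpha> n * \<bar>\<beta>0 $ j\<bar>)) n b" for b by blast
      have b0K: "norm (s *\<^sub>R (\<beta>0 - bstar)) \<le> K" using b0 by (simp add: u_def s_def)
      define w where "w = (\<lambda>j. \<eta> n / sqrt (1 + 2 * \<alpha> n * \<bar>\<beta>0 $ j\<bar>))"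
      have b0j: "s * \<bar>\<beta>0 $ j - bstar $ j\<bar> \<le> K" for j
        using order_trans[OF component_le_norm_cart b0K, of j] s by (simp add: abs_mult)
      have b1: "bstar + (1 / s) *\<^sub>R u n \<beta>1 = \<beta>1" using s by (simp add: u_def s_def)
      have obj: "lasso_objective x (\<lambda>i. x i \<bullet> bstar + e i) w n (bstar + (1 / s) *\<^sub>R v)
        = (\<Sum>i=1..n. (e i)\<^sup>2) + (v \<bullet> (gram x n *v v) - 2 * (v \<bullet> W n e)
          + (\<Sum>j\<in>UNIV. w j / s * \<bar>(s *\<^sub>R bstar) $ j + v $ j\<bar>))" for v
        unfolding W_def s_def by (rule lasso_objective_rescaled[OF elim(5)])
      have min: "u n \<beta>1 \<bullet> (gram x n *v u n \<beta>1) - 2 * (u n \<beta>1 \<bullet> W n e) + (\<Sum>j\<in>UNIV. w j / s * \<bar>(s *\<^sub>R bstar) $ j + u n \<beta>1 $ j\<bar>)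
        \<le> v \<bullet> (gram x n *v v) - 2 * (v \<bullet> W n e) + (\<Sum>j\<in>UNIV. w j / s * \<bar>(s *\<^sub>R bstar) $ j + v $ j\<bar>)" for v
        using b1_min[of "bstar + (1 / s) *\<^sub>R v", folded w_def, unfolded obj]
          obj[of "u n \<beta>1", unfolded b1] by linarith
      have \<kappa>n: "\<bar>v \<bullet> ((gram x n - C) *v v')\<bar> \<le> \<kappa> * norm v * norm v'" for v v'
      proof -
        have "\<bar>v \<bullet> ((gram x n - C) *v v')\<bar> \<le> m * norm (gram x n - C) * norm v * norm v'"
          unfolding m_def by (rule abs_inner_matrix_vector_le)
        also have "\<dots> \<le> \<kappa> * norm v * norm v'" using elim(1) by (intro mult_right_mono) auto
        finally show ?thesis .
      qed
      have L': "2 * R * (G + \<kappa>) + 2 * K < L" by (simp add: L_def)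
      have w_in: "\<forall>j\<in>A. 0 \<le> w j / s \<and> w j / s \<le> \<delta>"
        using elim(2) b0j unfolding w_def s_def by blast
      have w_out: "\<forall>j. j \<notin> A \<longrightarrow> (s *\<^sub>R bstar) $ j = 0 \<and> L \<le> w j / s"
      proof (intro allI impI)
        fix j assume "j \<notin> A"
        then have b: "bstar $ j = 0" by (simp add: A_def)
        have "s * \<bar>\<beta>0 $ j\<bar> \<le> K" using b0j[of j] b by simp
        then have "L \<le> w j / s" using elim(3) unfolding w_def s_def by blast
        with b show "(s *\<^sub>R bstar) $ j = 0 \<and> L \<le> w j / s" by simp
      qed
      note bounds = lasso_minimizer_bounds[OF min C_pd c transpose_gram
          abs_inner_matrix_vector_le[of _ C, folded m_def, folded G_def] \<kappa>n less_imp_le[OF \<kappa>] \<kappa>c WK w_in w_out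
          less_imp_le[OF \<delta>] R_def[unfolded m_def] L' G]
      have uR: "norm (u n \<beta>1) \<le> R" by (rule bounds(1))
      have u0: "u n \<beta>1 $ j = 0" if "j \<notin> A" for j by (rule bounds(2)[OF that])
      have "restrict_vec A (u n \<beta>1) = u n \<beta>1" using u0 by (simp add: restrict_vec_def vec_eq_iff)
      then have "norm (restrict_vec A (u n \<beta>1) - S0 *v W n e) \<le> (m * \<delta> + \<kappa> * (R + norm (S0 *v W n e))) / c"
        using bounds(3) by (simp add: S0_def m_def)
      also have "\<dots> \<le> \<rho>"
      proof -
        have "norm (S0 *v W n e) \<le> m * norm S0 * norm (W n e)" unfolding m_def by (rule norm_matrix_vector_mult_le)
        also have "\<dots> \<le> h" unfolding h_def using WK m by (intro mult_left_mono) auto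
        finally have "\<kappa> * (R + norm (S0 *v W n e)) \<le> \<kappa> * (R + h)" using \<kappa> by (intro mult_left_mono) auto
        moreover have "m * \<delta> = \<rho> * c / 2" using m by (simp add: \<delta>_def)
        ultimately show ?thesis using \<kappa>h c by (simp add: divide_le_eq)
      qed
      finally have near: "norm (restrict_vec A (u n \<beta>1) - S0 *v W n e) \<le> \<rho>" .
      have "\<beta>1 $ j \<noteq> 0 \<longleftrightarrow> j \<in> A" for j
      proof (cases "j \<in> A")
        case True
        have "R < s * \<bar>bstar $ j\<bar>" using elim(4) True by (auto simp: s_def A_def divide_less_eq)
        moreover have "\<bar>u n \<beta>1 $ j\<bar> \<le> R" using component_le_norm_cart[of "u n \<beta>1" j] uR by linarith
        ultimately have "\<bar>u n \<beta>1 $ j\<bar> < \<bar>s * bstar $ j\<bar>" using s by (simp add: abs_mult)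
        then have "s * bstar $ j + u n \<beta>1 $ j \<noteq> 0" by linarith
        moreover have "s * (\<beta>1 $ j) = s * bstar $ j + u n \<beta>1 $ j" by (simp add: u_def s_def right_diff_distrib)
        ultimately show ?thesis using True by auto
      next
        case False
        then show ?thesis using u0[OF False] s by (simp add: u_def s_def A_def)
      qed
      then have "{j. \<beta>1 $ j \<noteq> 0} = A" by auto
      with uR near show "{j. \<beta>1 $ j \<noteq> 0} = A \<and> norm (u n \<beta>1) \<le> R \<and>
        norm (restrict_vec A (u n \<beta>1) - S0 *v W n e) \<le> \<rho>" by blast
    qed
  qed
  then show ?thesis by blast
qed

theorem theorem3:
  fixes M :: "'a measure"
    and x :: "nat \<Rightarrow> real^'p"
    and bstar :: "real^'p"
    and \<epsilon> :: "nat \<Rightarrow> 'a \<Rightarrow> real"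
    and \<sigma> :: real
    and C :: "real^'p^'p"
    and b0 b1 :: "nat \<Rightarrow> 'a \<Rightarrow> real^'p"
    and \<eta> \<alpha> :: "nat \<Rightarrow> real"
    and c1 :: real
  defines "y \<equiv> (\<lambda>i \<omega>. x i \<bullet> bstar + \<epsilon> i \<omega>)"
    and "A \<equiv> {j. bstar $ j \<noteq> 0}"
  assumes M: "prob_space M"
    and eps_rv: "\<And>i. i \<ge> 1 \<Longrightarrow> \<epsilon> i \<in> borel_measurable M"
    and eps_indep: "prob_space.indep_vars M (\<lambda>_. borel) \<epsilon> {1..}"
    and eps_id: "\<And>i. i \<ge> 1 \<Longrightarrow> distr M borel (\<epsilon> i) = distr M borel (\<epsilon> 1)"
    and eps_int: "\<And>i. i \<ge> 1 \<Longrightarrow> integrable M (\<epsilon> i)"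
    and eps_mean: "\<And>i. i \<ge> 1 \<Longrightarrow> (\<integral>\<omega>. \<epsilon> i \<omega> \<partial>M) = 0"
    and eps_sq_int: "\<And>i. i \<ge> 1 \<Longrightarrow> integrable M (\<lambda>\<omega>. (\<epsilon> i \<omega>)\<^sup>2)"
    and eps_var: "\<And>i. i \<ge> 1 \<Longrightarrow> (\<integral>\<omega>. (\<epsilon> i \<omega>)\<^sup>2 \<partial>M) = \<sigma>\<^sup>2"
    and design: "(\<lambda>n. (1 / real n) *\<^sub>R (\<Sum>i=1..n. (\<chi> k l. x i $ k * x i $ l))) \<longlonglongrightarrow> C"
    and C_pd: "pos_def_mat C"
    and b0_rv: "\<And>n. b0 n \<in> borel_measurable M"
    and b0_cons: "bounded_in_prob M (\<lambda>n \<omega>. sqrt (real n) *\<^sub>R (b0 n \<omega> - bstar))"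
    and b1_rv: "\<And>n. b1 n \<in> borel_measurable M"
    and b1_min: "\<And>n \<omega> b. \<omega> \<in> space M \<Longrightarrow>
        (\<Sum>i=1..n. (y i \<omega> - x i \<bullet> b1 n \<omega>)\<^sup>2)
          + (\<Sum>j\<in>UNIV. \<eta> n / sqrt (1 + 2 * \<alpha> n * \<bar>b0 n \<omega> $ j\<bar>) * \<bar>b1 n \<omega> $ j\<bar>)
        \<le> (\<Sum>i=1..n. (y i \<omega> - x i \<bullet> b)\<^sup>2)
          + (\<Sum>j\<in>UNIV. \<eta> n / sqrt (1 + 2 * \<alpha> n * \<bar>b0 n \<omega> $ j\<bar>) * \<bar>b $ j\<bar>)"
    and eta1: "(\<lambda>n. \<eta> n / real n powr (3/4)) \<longlonglongrightarrow> 0"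
    and eta2: "filterlim (\<lambda>n. \<eta> n / sqrt (real n)) at_top sequentially"
    and alpha: "(\<lambda>n. \<alpha> n / sqrt (real n)) \<longlonglongrightarrow> c1"
    and c1: "0 < c1"
  shows "(\<lambda>n. measure M {\<omega>\<in>space M. {j. b1 n \<omega> $ j \<noteq> 0} = A}) \<longlonglongrightarrow> 1
    \<and> (\<exists>\<mu>. gaussian_law (\<sigma>\<^sup>2 *\<^sub>R sub_inv_embed A C) \<mu> \<and>
          conv_in_distr M (\<lambda>n \<omega>. restrict_vec A (sqrt (real n) *\<^sub>R (b1 n \<omega> - bstar))) \<mu>)"
proof -
  interpret M: prob_space M by fact
  define S0 where "S0 = sub_inv_embed A C"
  define W where "W = (\<lambda>n \<omega>. (1 / sqrt (real n)) *\<^sub>R (\<Sum>i=1..n. \<epsilon> i \<omega> *\<^sub>R x i))"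
  define u where "u = (\<lambda>n \<omega>. sqrt (real n) *\<^sub>R (b1 n \<omega> - bstar))"
  \<comment> \<open>The good event. Every probability estimate below is reduced to the size of its
    complement.\<close>
  define E where "E = (\<lambda>K n. {\<omega>\<in>space M. norm (W n \<omega>) \<le> K \<and> norm (sqrt (real n) *\<^sub>R (b0 n \<omega> - bstar)) \<le> K})"
  have gram: "gram x \<longlonglongrightarrow> C" using design by (simp add: gram_def[abs_def])
  note [measurable] = b0_rv b1_rv
  have W_rv[measurable]: "W n \<in> borel_measurable M" for n
    unfolding W_def using eps_rv by (intro borel_measurable_scaleR borel_measurable_sum) auto
  have E_ev: "E K n \<in> M.events" for K n unfolding E_def by measurable
  have tight_W: "\<exists>K. \<forall>\<^sub>F n in sequentially. M.prob {\<omega>\<in>space M. norm (W n \<omega>) > K} < e" if "0 < e" for e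
    unfolding W_def by (rule M.score_tight[OF gram eps_indep eps_int eps_sq_int eps_mean eps_var that])
  have good: "\<exists>K\<ge>0. \<forall>\<^sub>F n in sequentially. M.prob (space M - E K n) < e" if e: "0 < e" for e
  proof -
    obtain K1 where K1: "\<forall>\<^sub>F n in sequentially. M.prob {\<omega>\<in>space M. norm (W n \<omega>) > K1} < e / 2"
      using tight_W[of "e / 2"] e by auto
    obtain K2 where K2: "\<forall>\<^sub>F n in sequentially. M.prob {\<omega>\<in>space M. norm (sqrt (real n) *\<^sub>R (b0 n \<omega> - bstar)) > K2} < e / 2"
      using b0_cons e unfolding bounded_in_prob_def eventually_sequentially by (meson half_gt_zero)
    define K where "K = max 0 (max K1 K2)"
    have "\<forall>\<^sub>F n in sequentially. M.prob (space M - E K n) < e"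
      using K1 K2
    proof eventually_elim
      case (elim n)
      let ?A = "{\<omega>\<in>space M. norm (W n \<omega>) > K1}"
      let ?B = "{\<omega>\<in>space M. norm (sqrt (real n) *\<^sub>R (b0 n \<omega> - bstar)) > K2}"
      have ev: "?A \<in> M.events" "?B \<in> M.events" by measurable
      have "M.prob (space M - E K n) \<le> M.prob (?A \<union> ?B)"
        using ev by (intro M.finite_measure_mono) (auto simp: E_def K_def)
      also have "\<dots> \<le> M.prob ?A + M.prob ?B" by (rule measure_Un_le[OF ev])
      finally show ?case using elim by linarith
    qed
    moreover have "0 \<le> K" by (simp add: K_def)
    ultimately show ?thesis by blast
  qed

  have key: "\<exists>R. \<forall>\<^sub>F n in sequentially. \<forall>\<omega>\<in>E K n. {j. b1 n \<omega> $ j \<noteq> 0} = A \<and> norm (u n \<omega>) \<le> R \<and>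
      norm (restrict_vec A (u n \<omega>) - S0 *v W n \<omega>) \<le> \<rho>" if K: "0 \<le> K" and \<rho>: "0 < \<rho>" for K \<rho>
  proof -
    obtain R where R: "\<forall>\<^sub>F n in sequentially. \<forall>e \<beta>0 \<beta>1.
        norm ((1 / sqrt (real n)) *\<^sub>R (\<Sum>i=1..n. e i *\<^sub>R x i)) \<le> K \<and> norm (sqrt (real n) *\<^sub>R (\<beta>0 - bstar)) \<le> K \<and>
        (\<forall>b. lasso_objective x (\<lambda>i. x i \<bullet> bstar + e i) (\<lambda>j. \<eta> n / sqrt (1 + 2 * \<alpha> n * \<bar>\<beta>0 $ j\<bar>)) n \<beta>1
          \<le> lasso_objective x (\<lambda>i. x i \<bullet> bstar + e i) (\<lambda>j. \<eta> n / sqrt (1 + 2 * \<alpha> n * \<bar>\<beta>0 $ j\<bar>)) n b) \<longrightarrow>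
        {j. \<beta>1 $ j \<noteq> 0} = A \<and> norm (sqrt (real n) *\<^sub>R (\<beta>1 - bstar)) \<le> R \<and>
        norm (restrict_vec A (sqrt (real n) *\<^sub>R (\<beta>1 - bstar)) - S0 *v ((1 / sqrt (real n)) *\<^sub>R (\<Sum>i=1..n. e i *\<^sub>R x i))) \<le> \<rho>"
      using adaptive_lasso_eventually[OF gram C_pd eta1 eta2 alpha c1 K \<rho>, where bstar = bstar, folded A_def S0_def] by blast
    have "\<forall>\<^sub>F n in sequentially. \<forall>\<omega>\<in>E K n. {j. b1 n \<omega> $ j \<noteq> 0} = A \<and> norm (u n \<omega>) \<le> R \<and>
      norm (restrict_vec A (u n \<omega>) - S0 *v W n \<omega>) \<le> \<rho>"
      using R
    proof eventually_elim
      case (elim n)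
      show ?case
      proof
        fix \<omega> assume "\<omega> \<in> E K n"
        then have \<omega>: "\<omega> \<in> space M" "norm (W n \<omega>) \<le> K" "norm (sqrt (real n) *\<^sub>R (b0 n \<omega> - bstar)) \<le> K"
          by (simp_all add: E_def)
        have "\<forall>b. lasso_objective x (\<lambda>i. x i \<bullet> bstar + \<epsilon> i \<omega>) (\<lambda>j. \<eta> n / sqrt (1 + 2 * \<alpha> n * \<bar>b0 n \<omega> $ j\<bar>)) n (b1 n \<omega>)
          \<le> lasso_objective x (\<lambda>i. x i \<bullet> bstar + \<epsilon> i \<omega>) (\<lambda>j. \<eta> n / sqrt (1 + 2 * \<alpha> n * \<bar>b0 n \<omega> $ j\<bar>)) n b"
          using b1_min[OF \<omega>(1)] unfolding lasso_objective_def y_def by blast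
        with \<omega>(2,3) elim[rule_format, of "\<lambda>i. \<epsilon> i \<omega>" "b0 n \<omega>" "b1 n \<omega>"]
        show "{j. b1 n \<omega> $ j \<noteq> 0} = A \<and> norm (u n \<omega>) \<le> R \<and>
          norm (restrict_vec A (u n \<omega>) - S0 *v W n \<omega>) \<le> \<rho>"
          unfolding W_def u_def by blast
      qed
    qed
    then show ?thesis by blast
  qed

  have part1: "(\<lambda>n. measure M {\<omega>\<in>space M. {j. b1 n \<omega> $ j \<noteq> 0} = A}) \<longlonglongrightarrow> 1"
  proof (rule tendstoI)
    fix e :: real assume e: "0 < e"
    obtain K where K: "0 \<le> K" "\<forall>\<^sub>F n in sequentially. M.prob (space M - E K n) < e" using good[OF e] by blast
    obtain R where R: "\<forall>\<^sub>F n in sequentially. \<forall>\<omega>\<in>E K n. {j. b1 n \<omega> $ j \<noteq> 0} = A \<and> norm (u n \<omega>) \<le> R \<and>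
      norm (restrict_vec A (u n \<omega>) - S0 *v W n \<omega>) \<le> 1" using key[OF K(1), of 1] by auto
    show "\<forall>\<^sub>F n in sequentially. dist (measure M {\<omega>\<in>space M. {j. b1 n \<omega> $ j \<noteq> 0} = A}) 1 < e"
      using K(2) R
    proof eventually_elim
      case (elim n)
      \<comment> \<open>Written as a finite conjunction over coordinates, the set equality becomes
        visibly measurable.\<close>
      have "{\<omega>\<in>space M. {j. b1 n \<omega> $ j \<noteq> 0} = A} = {\<omega>\<in>space M. \<forall>j. b1 n \<omega> $ j \<noteq> 0 \<longleftrightarrow> j \<in> A}" by auto
      also have "\<dots> \<in> M.events" by measurable
      finally have ev: "{\<omega>\<in>space M. {j. b1 n \<omega> $ j \<noteq> 0} = A} \<in> M.events" .
      have "M.prob (E K n) \<le> measure M {\<omega>\<in>space M. {j. b1 n \<omega> $ j \<noteq> 0} = A}"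
        using elim(2) ev by (intro M.finite_measure_mono) (auto simp: E_def)
      then show ?case using elim(1) M.prob_compl[OF E_ev] M.prob_le_1[of "{\<omega>\<in>space M. {j. b1 n \<omega> $ j \<noteq> 0} = A}"]
        by (simp add: dist_real_def)
    qed
  qed

  have S0_form: "t \<bullet> (S0 *v t) = (S0 *v t) \<bullet> (C *v (S0 *v t))" for t
    unfolding S0_def by (rule sub_inv_embed_form[OF C_pd, symmetric])
  \<comment> \<open>The covariance is singular if some coordinate is inactive; S0 = S0 C S0 shows
    that it is still positive semidefinite.\<close>
  have "\<exists>\<mu>. gaussian_law (\<sigma>\<^sup>2 *\<^sub>R S0) \<mu>"
  proof (rule gaussian_law_exists)
    show "transpose (\<sigma>\<^sup>2 *\<^sub>R S0) = \<sigma>\<^sup>2 *\<^sub>R S0"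
      by (simp add: transpose_scalar S0_def transpose_sub_inv_embed[OF C_pd])
    have "0 \<le> v \<bullet> (C *v v)" for v using C_pd by (cases "v = 0") (auto simp: pos_def_mat_def intro: less_imp_le)
    then show "0 \<le> t \<bullet> ((\<sigma>\<^sup>2 *\<^sub>R S0) *v t)" for t
      by (simp add: scaleR_matrix_vector_assoc[symmetric] S0_form)
  qed
  then obtain \<mu> where \<mu>: "gaussian_law (\<sigma>\<^sup>2 *\<^sub>R S0) \<mu>" by blast
  define Y where "Y = (\<lambda>n \<omega>. restrict_vec A (u n \<omega>))"
  have Y_rv[measurable]: "Y n \<in> borel_measurable M" for n
  proof -
    have "continuous_on UNIV (\<lambda>v::real^'p. if j \<in> A then v $ j else 0)" for j
      by (cases "j \<in> A") (auto intro!: continuous_intros)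
    then have "continuous_on UNIV (restrict_vec A :: real^'p \<Rightarrow> real^'p)"
      unfolding restrict_vec_def[abs_def] by (intro continuous_on_vec_lambda)
    then show ?thesis unfolding Y_def u_def by (rule borel_measurable_continuous_on) measurable
  qed
  have Z_rv[measurable]: "(\<lambda>\<omega>. S0 *v W n \<omega>) \<in> borel_measurable M" for n
    by (rule borel_measurable_continuous_on[OF _ W_rv])
      (intro linear_continuous_on matrix_vector_mul_bounded_linear)

  have cf_Y: "(\<lambda>n. LINT \<omega>|M. cis (t \<bullet> Y n \<omega>)) \<longlonglongrightarrow> (LINT z|\<mu>. cis (t \<bullet> z))" for t
  proof -
    have "(\<lambda>n. LINT \<omega>|M. cis (t \<bullet> (S0 *v W n \<omega>))) \<longlonglongrightarrow> complex_of_real (exp (- (\<sigma>\<^sup>2 * ((S0 *v t) \<bullet> (C *v (S0 *v t)))) / 2))"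
      using M.cf_score_tendsto[OF gram eps_indep eps_id eps_int eps_sq_int eps_mean eps_var, of "S0 *v t"] by (simp only: S0_def W_def sub_inv_embed_inner[OF C_pd])
    also have "complex_of_real (exp (- (\<sigma>\<^sup>2 * ((S0 *v t) \<bullet> (C *v (S0 *v t)))) / 2)) = (LINT z|\<mu>. cis (t \<bullet> z))"
      using \<mu> by (simp add: gaussian_law_def scaleR_matrix_vector_assoc[symmetric] S0_form)
    finally have lim: "(\<lambda>n. LINT \<omega>|M. cis (t \<bullet> (S0 *v W n \<omega>))) \<longlonglongrightarrow> (LINT z|\<mu>. cis (t \<bullet> z))" .
    have "(\<lambda>n. (LINT \<omega>|M. cis (t \<bullet> Y n \<omega>)) - (LINT \<omega>|M. cis (t \<bullet> (S0 *v W n \<omega>)))) \<longlonglongrightarrow> 0"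
    proof (rule tendstoI)
      fix e :: real assume e: "0 < e"
      \<comment> \<open>The approximation error contributes at most e / 2, and the bad event, of
        probability below e / 4, is counted twice.\<close>
      define \<rho> where "\<rho> = e / (2 * (norm t + 1))"
      have t1: "0 < norm t + 1" by (simp add: add_nonneg_pos)
      have \<rho>: "0 < \<rho>" using e t1 by (simp add: \<rho>_def)
      have "norm t * \<rho> \<le> (norm t + 1) * \<rho>" using \<rho> by simp
      also have "\<dots> = e / 2" using t1 by (simp add: \<rho>_def divide_simps)
      finally have t\<rho>: "norm t * \<rho> \<le> e / 2" .
      obtain K where K: "0 \<le> K" "\<forall>\<^sub>F n in sequentially. M.prob (space M - E K n) < e / 4" using good[of "e / 4"] e by auto
      obtain R where R: "\<forall>\<^sub>F n in sequentially. \<forall>\<omega>\<in>E K n. {j. b1 n \<omega> $ j \<noteq> 0} = A \<and> norm (u n \<omega>) \<le> R \<and>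
        norm (restrict_vec A (u n \<omega>) - S0 *v W n \<omega>) \<le> \<rho>" using key[OF K(1) \<rho>] by auto
      show "\<forall>\<^sub>F n in sequentially. dist ((LINT \<omega>|M. cis (t \<bullet> Y n \<omega>)) - (LINT \<omega>|M. cis (t \<bullet> (S0 *v W n \<omega>)))) 0 < e"
        using K(2) R
      proof eventually_elim
        case (elim n)
        have "norm ((LINT \<omega>|M. cis (t \<bullet> Y n \<omega>)) - (LINT \<omega>|M. cis (t \<bullet> (S0 *v W n \<omega>))))
          \<le> norm t * \<rho> + 2 * M.prob (space M - E K n)"
          by (rule M.cf_diff_le[OF Y_rv Z_rv E_ev]) (use elim(2) \<rho> in \<open>auto simp: Y_def\<close>)
        then show ?case using elim(1) t\<rho> by simp
      qed
    qed
    from tendsto_add[OF this lim] show ?thesis by simp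
  qed
  \<comment> \<open>On the good event the rescaled minimizer obeys the deterministic bound
    \<open>R\<close>, so no moment of the estimator is required.\<close>
  have tight_Y: "\<exists>K. \<forall>\<^sub>F n in sequentially. M.prob {\<omega>\<in>space M. norm (Y n \<omega>) > K} < e" if e: "0 < e" for e
  proof -
    obtain K where K: "0 \<le> K" "\<forall>\<^sub>F n in sequentially. M.prob (space M - E K n) < e" using good[OF e] by blast
    obtain R where R: "\<forall>\<^sub>F n in sequentially. \<forall>\<omega>\<in>E K n. {j. b1 n \<omega> $ j \<noteq> 0} = A \<and> norm (u n \<omega>) \<le> R \<and>
      norm (restrict_vec A (u n \<omega>) - S0 *v W n \<omega>) \<le> 1" using key[OF K(1), of 1] by auto
    have Yu: "norm (Y n \<omega>) \<le> norm (u n \<omega>)" for n \<omega>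
      by (rule norm_le_componentwise_cart) (simp add: Y_def restrict_vec_def)
    have "\<forall>\<^sub>F n in sequentially. M.prob {\<omega>\<in>space M. norm (Y n \<omega>) > R} < e"
      using K(2) R
    proof eventually_elim
      case (elim n)
      have "M.prob {\<omega>\<in>space M. norm (Y n \<omega>) > R} \<le> M.prob (space M - E K n)"
      proof (rule M.finite_measure_mono)
        have "norm (Y n \<omega>) \<le> R" if "\<omega> \<in> E K n" for \<omega>
          using Yu[of n \<omega>] bspec[OF elim(2) that] by linarith
        then show "{\<omega>\<in>space M. norm (Y n \<omega>) > R} \<subseteq> space M - E K n" by (auto simp: not_le[symmetric])
        show "space M - E K n \<in> M.events" using E_ev by auto
      qed
      with elim(1) show ?case by simp
    qed
    then show ?thesis by blast
  qed
  have "conv_in_distr M Y \<mu>"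
    unfolding conv_in_distr_def
  proof (intro allI impI)
    fix f :: "real^'p \<Rightarrow> real" assume f: "continuous_on UNIV f" "bounded (range f)"
    have "(\<lambda>n. LINT \<omega>|M. f (Y n \<omega>)) \<longlonglongrightarrow> (LINT z|\<mu>. f z)"
      using \<mu> by (intro levy_continuity_tight[OF M Y_rv _ _ cf_Y tight_Y f]) (auto simp: gaussian_law_def)
    then show "(\<lambda>n. integral\<^sup>L (distr M borel (Y n)) f) \<longlonglongrightarrow> integral\<^sup>L \<mu> f"
      by (simp add: integral_distr[OF Y_rv borel_measurable_continuous_onI[OF f(1)]])
  qed
  with part1 \<mu> show ?thesis unfolding S0_def Y_def u_def by blast
qed

end
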